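(* Let $(M,g)$ be a smooth spacetime such that the causal relation $\{(x,y)\in M^2:x\le y\}$ is closed in $M^2$. Then the following are equivalent: (i) $(M,g)$ is globally hyperbolic; (ii) $(M,g)$ is chronologically forward complete; (iii) $(M,g)$ is chronologically backward complete; (iv) $(M,g)$ is causally forward complete; (v) $(M,g)$ is causally backward complete.
   Context: A smooth spacetime is a (finite-dimensional, connected) time-oriented smooth Lorentzian manifold; $\le$ and $\ll$ denote its causal and timelike (chronological) relations. Globally hyperbolic: causal (no closed causal curves) and all causal diamonds $J(x,y)=\{z:x\le z\le y\}$ compact. Causally forward complete: every sequence $(x_n)\subseteq M$ with $x_n\le x_{n+1}\le z$ for all $n\in\mathbb N$ and some $z\in M$ converges in $M$. Causally backward complete: causally forward complete with respect to the opposite time orientation. Chronologically forward complete: every sequence with $x_n\ll x_{n+1}\ll z$ for all $n$ and some $z\in M$ converges in $M$. Chronologically backward complete: the time-reversal is chronologically forward complete. *)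

theory Defs
  imports "HOL-Analysis.Analysis"
begin

section \<open>Smooth maps on open sets\<close>

text \<open>Intended for open \<open>S\<close> only: \<^const>\<open>frechet_derivative\<close> is taken in the full space, and
  derivatives of order \<open>k\<close> are the iterated directional derivatives.\<close>

primrec Ck_on :: "nat \<Rightarrow> 'e::euclidean_space set \<Rightarrow> ('e \<Rightarrow> 'f::euclidean_space) \<Rightarrow> bool" where
  "Ck_on 0 S f \<longleftrightarrow> continuous_on S f"
| "Ck_on (Suc k) S f \<longleftrightarrow>
     (\<forall>x\<in>S. f differentiable (at x)) \<and>
     (\<forall>v. Ck_on k S (\<lambda>x. frechet_derivative f (at x) v))"

definition smooth_on :: "'e::euclidean_space set \<Rightarrow> ('e \<Rightarrow> 'f::euclidean_space) \<Rightarrow> bool" where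
  "smooth_on S f \<longleftrightarrow> (\<forall>k. Ck_on k S f)"


section \<open>Charts and atlases\<close>

text \<open>The manifold is the whole type \<open>'a\<close>, with its topology; the model space is \<open>'e\<close>, so the
  dimension is \<open>DIM('e)\<close>. A chart is an open domain together with a coordinate map, whose values
  outside the domain are irrelevant.\<close>

type_synonym ('a, 'e) chart = "'a set \<times> ('a \<Rightarrow> 'e)"

abbreviation chart_dom :: "('a, 'e) chart \<Rightarrow> 'a set" where
  "chart_dom c \<equiv> fst c"

abbreviation chart_map :: "('a, 'e) chart \<Rightarrow> 'a \<Rightarrow> 'e" where
  "chart_map c \<equiv> snd c"

definition chart_inv :: "('a, 'e) chart \<Rightarrow> 'e \<Rightarrow> 'a" where
  "chart_inv c = inv_into (chart_dom c) (chart_map c)"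

definition is_chart :: "('a::topological_space, 'e::euclidean_space) chart \<Rightarrow> bool" where
  "is_chart c \<longleftrightarrow> open (chart_dom c) \<and> open (chart_map c ` chart_dom c) \<and>
     homeomorphism (chart_dom c) (chart_map c ` chart_dom c) (chart_map c) (chart_inv c)"

definition transition :: "('a, 'e) chart \<Rightarrow> ('a, 'e) chart \<Rightarrow> 'e \<Rightarrow> 'e" where
  "transition c d = chart_map d \<circ> chart_inv c"

text \<open>The differential at \<open>x\<close> of the change of coordinates from \<open>c\<close> to \<open>d\<close>.\<close>

definition change_of_coords ::
  "('a, 'e::euclidean_space) chart \<Rightarrow> ('a, 'e) chart \<Rightarrow> 'a \<Rightarrow> 'e \<Rightarrow> 'e" where
  "change_of_coords c d x = frechet_derivative (transition c d) (at (chart_map c x))"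

definition smooth_atlas :: "('a::topological_space, 'e::euclidean_space) chart set \<Rightarrow> bool" where
  "smooth_atlas \<A> \<longleftrightarrow> (\<forall>c\<in>\<A>. is_chart c) \<and> (\<Union>c\<in>\<A>. chart_dom c) = UNIV \<and>
     (\<forall>c\<in>\<A>. \<forall>d\<in>\<A>. smooth_on (chart_map c ` (chart_dom c \<inter> chart_dom d)) (transition c d))"


section \<open>Lorentzian metrics and spacetimes\<close>

text \<open>Tensor fields are given by their components in the charts of the atlas:
  \<open>metric M c x u v\<close> is the value of the metric at \<open>x\<close> on the two tangent vectors whose
  coordinate representations in \<open>c\<close> are \<open>u\<close> and \<open>v\<close>, and \<open>time_field M c x\<close> is the
  coordinate representation in \<open>c\<close> of the value at \<open>x\<close> of a timelike vector field
  representing the time orientation. Components are meaningful only for \<open>c\<close> in the atlas and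
  \<open>x\<close> in the domain of \<open>c\<close>.\<close>

record ('a, 'e) lorentz_structure =
  atlas :: "('a, 'e) chart set"
  metric :: "('a, 'e) chart \<Rightarrow> 'a \<Rightarrow> 'e \<Rightarrow> 'e \<Rightarrow> real"
  time_field :: "('a, 'e) chart \<Rightarrow> 'a \<Rightarrow> 'e"

text \<open>Signature \<open>(-,+,\<dots>,+)\<close>.\<close>

definition lorentz_form :: "('e::euclidean_space \<Rightarrow> 'e \<Rightarrow> real) \<Rightarrow> bool" where
  "lorentz_form b \<longleftrightarrow> bilinear b \<and> (\<forall>u v. b u v = b v u) \<and>
     (\<exists>B. independent B \<and> span B = UNIV \<and>
       (\<forall>u\<in>B. \<forall>v\<in>B. u \<noteq> v \<longrightarrow> b u v = 0) \<and>
       (\<exists>e\<in>B. b e e = -1 \<and> (\<forall>u\<in>B - {e}. b u u = 1)))"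

definition lorentz_metric ::
  "('a::topological_space, 'e::euclidean_space) lorentz_structure \<Rightarrow> bool" where
  "lorentz_metric M \<longleftrightarrow>
     (\<forall>c\<in>atlas M. \<forall>x\<in>chart_dom c. lorentz_form (metric M c x)) \<and>
     (\<forall>c\<in>atlas M. \<forall>u v.
        smooth_on (chart_map c ` chart_dom c) (\<lambda>y. metric M c (chart_inv c y) u v)) \<and>
     (\<forall>c\<in>atlas M. \<forall>d\<in>atlas M. \<forall>x\<in>chart_dom c \<inter> chart_dom d. \<forall>u v.
        metric M c x u v =
          metric M d x (change_of_coords c d x u) (change_of_coords c d x v))"

definition time_oriented ::
  "('a::topological_space, 'e::euclidean_space) lorentz_structure \<Rightarrow> bool" where
  "time_oriented M \<longleftrightarrow>
     (\<forall>c\<in>atlas M. continuous_on (chart_dom c) (time_field M c)) \<and>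
     (\<forall>c\<in>atlas M. \<forall>d\<in>atlas M. \<forall>x\<in>chart_dom c \<inter> chart_dom d.
        time_field M d x = change_of_coords c d x (time_field M c x)) \<and>
     (\<forall>c\<in>atlas M. \<forall>x\<in>chart_dom c. metric M c x (time_field M c x) (time_field M c x) < 0)"

definition spacetime ::
  "('a::{t2_space, second_countable_topology}, 'e::euclidean_space) lorentz_structure \<Rightarrow> bool"
  where
  "spacetime M \<longleftrightarrow> connected (UNIV :: 'a set) \<and> smooth_atlas (atlas M) \<and>
     lorentz_metric M \<and> time_oriented M"

definition time_reversal :: "('a, 'e::euclidean_space) lorentz_structure \<Rightarrow> ('a, 'e) lorentz_structure"
  where
  "time_reversal M = M\<lparr>time_field := \<lambda>c x. - time_field M c x\<rparr>"


section \<open>Causal and timelike curves\<close>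

text \<open>Tangent vectors at \<open>x\<close>, in the coordinates of the chart \<open>c\<close>. A causal vector \<open>v \<noteq> 0\<close>
  lies in the same cone as the timelike vector \<open>X\<close> iff \<open>g(X,v) < 0\<close>.\<close>

definition future_causal ::
  "('a, 'e::euclidean_space) lorentz_structure \<Rightarrow> ('a, 'e) chart \<Rightarrow> 'a \<Rightarrow> 'e \<Rightarrow> bool" where
  "future_causal M c x v \<longleftrightarrow>
     v \<noteq> 0 \<and> metric M c x v v \<le> 0 \<and> metric M c x (time_field M c x) v < 0"

definition future_timelike ::
  "('a, 'e::euclidean_space) lorentz_structure \<Rightarrow> ('a, 'e) chart \<Rightarrow> 'a \<Rightarrow> 'e \<Rightarrow> bool" where
  "future_timelike M c x v \<longleftrightarrow>
     metric M c x v v < 0 \<and> metric M c x (time_field M c x) v < 0"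

text \<open>\<open>\<gamma>\<close> is \<open>C\<^sup>1\<close> on the compact interval \<open>S\<close>, with one-sided derivatives at the endpoints, and
  its velocity satisfies \<open>P\<close> throughout \<open>S\<close>.\<close>

definition C1_curve_on ::
  "('a::topological_space, 'e::euclidean_space) lorentz_structure \<Rightarrow>
   (('a, 'e) chart \<Rightarrow> 'a \<Rightarrow> 'e \<Rightarrow> bool) \<Rightarrow> real set \<Rightarrow> (real \<Rightarrow> 'a) \<Rightarrow> bool" where
  "C1_curve_on M P S \<gamma> \<longleftrightarrow> continuous_on S \<gamma> \<and>
     (\<forall>c\<in>atlas M. \<exists>\<gamma>'.
        continuous_on {t\<in>S. \<gamma> t \<in> chart_dom c} \<gamma>' \<and>
        (\<forall>t\<in>S. \<gamma> t \<in> chart_dom c \<longrightarrow>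
           ((chart_map c \<circ> \<gamma>) has_vector_derivative \<gamma>' t) (at t within S) \<and>
           P c (\<gamma> t) (\<gamma>' t)))"

definition piecewise_C1_curve ::
  "('a::topological_space, 'e::euclidean_space) lorentz_structure \<Rightarrow>
   (('a, 'e) chart \<Rightarrow> 'a \<Rightarrow> 'e \<Rightarrow> bool) \<Rightarrow> real \<Rightarrow> real \<Rightarrow> (real \<Rightarrow> 'a) \<Rightarrow> bool" where
  "piecewise_C1_curve M P a b \<gamma> \<longleftrightarrow>
     (\<exists>n::nat. \<exists>s::nat \<Rightarrow> real. n > 0 \<and> s 0 = a \<and> s n = b \<and>
        (\<forall>i<n. s i < s (Suc i) \<and> C1_curve_on M P {s i..s (Suc i)} \<gamma>))"

definition causal_curve ::
  "('a::topological_space, 'e::euclidean_space) lorentz_structure \<Rightarrow>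
   real \<Rightarrow> real \<Rightarrow> (real \<Rightarrow> 'a) \<Rightarrow> bool" where
  "causal_curve M = piecewise_C1_curve M (future_causal M)"

definition timelike_curve ::
  "('a::topological_space, 'e::euclidean_space) lorentz_structure \<Rightarrow>
   real \<Rightarrow> real \<Rightarrow> (real \<Rightarrow> 'a) \<Rightarrow> bool" where
  "timelike_curve M = piecewise_C1_curve M (future_timelike M)"

definition causal_rel ::
  "('a::topological_space, 'e::euclidean_space) lorentz_structure \<Rightarrow> 'a \<Rightarrow> 'a \<Rightarrow> bool"
  (\<open>(_ \<preceq>\<index> _)\<close> [51, 51] 50) where
  "x \<preceq>\<^bsub>M\<^esub> y \<longleftrightarrow> x = y \<or> (\<exists>a b \<gamma>. causal_curve M a b \<gamma> \<and> \<gamma> a = x \<and> \<gamma> b = y)"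

definition timelike_rel ::
  "('a::topological_space, 'e::euclidean_space) lorentz_structure \<Rightarrow> 'a \<Rightarrow> 'a \<Rightarrow> bool"
  (\<open>(_ \<lless>\<index> _)\<close> [51, 51] 50) where
  "x \<lless>\<^bsub>M\<^esub> y \<longleftrightarrow> (\<exists>a b \<gamma>. timelike_curve M a b \<gamma> \<and> \<gamma> a = x \<and> \<gamma> b = y)"


section \<open>Global hyperbolicity and order completeness\<close>

definition causal ::
  "('a::topological_space, 'e::euclidean_space) lorentz_structure \<Rightarrow> bool" where
  "causal M \<longleftrightarrow> \<not> (\<exists>a b \<gamma>. causal_curve M a b \<gamma> \<and> \<gamma> a = \<gamma> b)"

definition causal_diamond ::
  "('a::topological_space, 'e::euclidean_space) lorentz_structure \<Rightarrow> 'a \<Rightarrow> 'a \<Rightarrow> 'a set" where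
  "causal_diamond M x y = {z. x \<preceq>\<^bsub>M\<^esub> z \<and> z \<preceq>\<^bsub>M\<^esub> y}"

definition globally_hyperbolic ::
  "('a::topological_space, 'e::euclidean_space) lorentz_structure \<Rightarrow> bool" where
  "globally_hyperbolic M \<longleftrightarrow> causal M \<and> (\<forall>x y. compact (causal_diamond M x y))"

definition causally_forward_complete ::
  "('a::topological_space, 'e::euclidean_space) lorentz_structure \<Rightarrow> bool" where
  "causally_forward_complete M \<longleftrightarrow>
     (\<forall>(x :: nat \<Rightarrow> 'a) z.
        (\<forall>n. x n \<preceq>\<^bsub>M\<^esub> x (Suc n) \<and> x (Suc n) \<preceq>\<^bsub>M\<^esub> z) \<longrightarrow> convergent x)"

definition causally_backward_complete ::
  "('a::topological_space, 'e::euclidean_space) lorentz_structure \<Rightarrow> bool" where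
  "causally_backward_complete M \<longleftrightarrow> causally_forward_complete (time_reversal M)"

definition chronologically_forward_complete ::
  "('a::topological_space, 'e::euclidean_space) lorentz_structure \<Rightarrow> bool" where
  "chronologically_forward_complete M \<longleftrightarrow>
     (\<forall>(x :: nat \<Rightarrow> 'a) z.
        (\<forall>n. x n \<lless>\<^bsub>M\<^esub> x (Suc n) \<and> x (Suc n) \<lless>\<^bsub>M\<^esub> z) \<longrightarrow> convergent x)"

definition chronologically_backward_complete ::
  "('a::topological_space, 'e::euclidean_space) lorentz_structure \<Rightarrow> bool" where
  "chronologically_backward_complete M \<longleftrightarrow> chronologically_forward_complete (time_reversal M)"

end

theory Submission
  imports Defs
begin

text \<open>Chronological forward completeness makes \<open>\<preceq>\<close> antisymmetric and gives every increasing sequence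
  \<open>x\<^sub>n \<preceq> z\<close> an upper bound: by push-up and openness of timelike futures one finds \<open>u\<^sub>n \<lless> x\<^sub>n\<close>
  arbitrarily close to \<open>x\<^sub>n\<close> with \<open>u\<^sub>n \<lless> u\<^sub>n\<^sub>+\<^sub>1\<close>. If a diamond \<open>J(x, y)\<close> contained a sequence \<open>z\<^sub>n\<close>
  without convergent subsequence, consider the points \<open>w \<succeq> x\<close> that are limits of points in the pasts of
  \<open>z\<^sub>n\<close> for infinitely many \<open>n\<close>. Chains of such points are separable, hence have upper bounds, so Zorn's
  lemma gives a maximal \<open>w\<close>. But causal curves from near \<open>w\<close> to \<open>z\<^sub>n\<close> must leave a fixed compact
  neighbourhood of \<open>w\<close>, and an accumulation point of the exit points is strictly larger. This replaces
  the usual limit curve argument.\<close>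

section \<open>Closed causal relations and order completeness\<close>

text \<open>Limits of piecewise C1 causal curves need not be piecewise C1, so only limits of points
  are taken: closedness of \<unlhd> controls them, and connectedness of an individual curve enters
  through \<open>frontier_crossing\<close>. The order-theoretic half can therefore run in a bare
  topological space, and the geometry reduces to checking the conditions of this locale. The
  demanding one is \<open>push_up\<close>, where causal segments are deformed into timelike ones
  inside a chart. The conditions are one-sided: \<open>open_future\<close> and
  \<open>past_dense\<close> are paired without their duals, because the backward statements come
  from applying the forward ones to the reversed orientation. Completeness speaks of \<lhd>, also in
  its bound \<open>z\<close>, while the sequences of interest increase only for \<unlhd>. Points
  \<open>u \<lhd> x\<close> with \<open>x \<unlhd> z\<close> satisfy \<open>u \<lhd> z\<close>,
  which is what makes completeness applicable to them.\<close>

locale closed_causal_space =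
  fixes le :: "'a::{t2_space, second_countable_topology} \<Rightarrow> 'a \<Rightarrow> bool"  (infix \<open>\<unlhd>\<close> 50)
    and ll :: "'a \<Rightarrow> 'a \<Rightarrow> bool"  (infix \<open>\<lhd>\<close> 50)
  assumes le_refl [simp]: "x \<unlhd> x"
    and le_trans [trans]: "x \<unlhd> y \<Longrightarrow> y \<unlhd> z \<Longrightarrow> x \<unlhd> z"
    and closed_le: "closed {(x, y). x \<unlhd> y}"
    and ll_imp_le: "x \<lhd> y \<Longrightarrow> x \<unlhd> y"
    and push_up: "x \<lhd> y \<Longrightarrow> y \<unlhd> z \<Longrightarrow> x \<lhd> z"
    and open_future: "open {y. x \<lhd> y}"
    and past_dense: "x \<in> closure {p. p \<lhd> x}"
    and frontier_crossing: "x \<unlhd> y \<Longrightarrow> x \<in> U \<Longrightarrow> y \<notin> U \<Longrightarrow> \<exists>q\<in>frontier U. x \<unlhd> q \<and> q \<unlhd> y"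
    and compact_nhd: "\<exists>U. compact U \<and> x \<in> interior U"
begin

lemma le_limit:
  assumes "u \<longlonglongrightarrow> x" "v \<longlonglongrightarrow> y" "\<And>n. u n \<unlhd> v n"
  shows "x \<unlhd> y"
proof -
  have "(\<lambda>n. (u n, v n)) \<longlonglongrightarrow> (x, y)"
    using assms(1,2) by (rule tendsto_Pair)
  then have "(x, y) \<in> {(x, y). x \<unlhd> y}"
    by (rule closed_sequentially[OF closed_le, rotated]) (use assms(3) in auto)
  then show ?thesis by simp
qed

lemma closed_past: "closed {x. x \<unlhd> y}"
  using closed_vimage[OF closed_le, of "\<lambda>x. (x, y)"] by (simp add: continuous_on_Pair vimage_def)

lemma closed_future: "closed {y. x \<unlhd> y}"
  using closed_vimage[OF closed_le, of "\<lambda>y. (x, y)"] by (simp add: continuous_on_Pair vimage_def)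

lemma approximate_below:
  assumes "x \<in> W" "open W"
  shows "\<exists>p\<in>W. p \<lhd> x"
proof -
  have "W \<inter> {p. p \<lhd> x} \<noteq> {}"
    using open_Int_closure_eq_empty[OF assms(2)] past_dense[of x] assms(1) by blast
  then show ?thesis by blast
qed

text \<open>Every subsequential limit lies above the whole sequence, because futures are closed, and
  hence above every other subsequential limit. Antisymmetry leaves a single cluster point, and
  compactness turns it into a limit.\<close>

lemma convergent_in_compact_diamond:
  assumes antisym: "\<And>x y. x \<unlhd> y \<Longrightarrow> y \<unlhd> x \<Longrightarrow> x = y"
    and compact: "compact {y. u 0 \<unlhd> y \<and> y \<unlhd> z}"
    and u: "\<And>n. u n \<unlhd> u (Suc n)" "\<And>n. u n \<unlhd> z"
  shows "convergent u"
proof -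
  have mono: "u m \<unlhd> u n" if "m \<le> n" for m n
    using that by (induction rule: dec_induct) (auto intro: le_trans u)
  have bound: "u n \<unlhd> p" if p: "(u \<circ> r) \<longlonglongrightarrow> p" and r: "strict_mono r" for n p and r :: "nat \<Rightarrow> nat"
  proof -
    have "eventually (\<lambda>k. (u \<circ> r) k \<in> {y. u n \<unlhd> y}) sequentially"
      unfolding eventually_sequentially
      using mono[OF order_trans[OF _ seq_suble[OF r]]] by (intro exI[of _ n]) simp
    then show ?thesis using Lim_in_closed_set[OF closed_future _ _ p] by auto
  qed
  have seq: "seq_compact {y. u 0 \<unlhd> y \<and> y \<unlhd> z}" by (rule compact_imp_seq_compact[OF compact])
  have J: "u n \<in> {y. u 0 \<unlhd> y \<and> y \<unlhd> z}" for n using mono[of 0 n] u(2) by auto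
  obtain l r where l: "strict_mono r" "(u \<circ> r) \<longlonglongrightarrow> l"
    using seq_compactE[OF seq, of u] J by metis
  have "u \<longlonglongrightarrow> l"
  proof (rule topological_tendstoI, rule ccontr)
    \<comment> \<open>Terms outside \<open>U\<close>, if infinitely many, would have a cluster point
      \<open>p\<close> outside \<open>U\<close>; yet \<open>p\<close> and \<open>l\<close> bound
      each other.\<close>
    fix U assume U: "open U" "l \<in> U" and "\<not> (\<forall>\<^sub>F n in sequentially. u n \<in> U)"
    then have "infinite {n. u n \<notin> U}"
      unfolding infinite_nat_iff_unbounded_le eventually_sequentially by auto
    then obtain s :: "nat \<Rightarrow> nat" where s: "strict_mono s" "\<And>n. u (s n) \<notin> U"
      using infinite_enumerate[of "{n. u n \<notin> U}"] by blast
    obtain p t where t: "strict_mono t" "((u \<circ> s) \<circ> t) \<longlonglongrightarrow> p"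
      using seq_compactE[OF seq, of "u \<circ> s"] J by (metis comp_apply)
    have "strict_mono (s \<circ> t)" using s(1) t(1) by (rule strict_mono_o)
    then have "u n \<unlhd> p" for n using bound[of "s \<circ> t"] t(2) by (simp add: comp_assoc)
    then have "l \<unlhd> p" using le_limit[OF l(2) tendsto_const] by simp
    moreover have "p \<unlhd> l" using le_limit[OF t(2) tendsto_const] bound[OF l(2,1)] by simp
    ultimately have "p = l" using antisym by blast
    moreover have "p \<in> - U"
      by (rule closed_sequentially[OF _ _ t(2)]) (use U s(2) in auto)
    ultimately show False using U(2) by blast
  qed
  then show ?thesis unfolding convergent_def ..
qed

end

section \<open>Compactness of causal diamonds from chronological completeness\<close>

locale chronologically_complete_space = closed_causal_space +
  assumes complete: "(\<And>n. u n \<lhd> u (Suc n) \<and> u (Suc n) \<lhd> z) \<Longrightarrow> convergent u"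
begin

text \<open>The sets \<open>W n\<close> prescribe how close \<open>u n\<close> must be to
  \<open>x n\<close>. Since \<open>u n \<lhd> x n\<close>, \<open>push_up\<close> places
  \<open>x (Suc n)\<close> in the open future of \<open>u n\<close>, so the next point can be chosen
  there. How the limit \<open>l\<close> relates to \<open>x\<close> depends entirely on the choice
  of \<open>W\<close>.\<close>

lemma approximating_sequence:
  assumes x: "\<And>n. x n \<unlhd> x (Suc n)" "\<And>n. x n \<unlhd> z"
    and W: "\<And>n. open (W n)" "\<And>n. x n \<in> W n"
  obtains u l where "\<And>n. u n \<in> W n" "\<And>n. u n \<lhd> x n" "u \<longlonglongrightarrow> l"
proof -
  have "\<exists>u. \<forall>n. (u n \<in> W n \<and> u n \<lhd> x n) \<and> u n \<lhd> u (Suc n)"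
  proof (rule dependent_nat_choice)
    show "\<exists>p. p \<in> W 0 \<and> p \<lhd> x 0" using approximate_below[of "x 0" "W 0"] W by blast
  next
    fix p n assume p: "p \<in> W n \<and> p \<lhd> x n"
    then have "x (Suc n) \<in> W (Suc n) \<inter> {y. p \<lhd> y}" using push_up x W by blast
    then obtain q where "q \<in> W (Suc n) \<inter> {y. p \<lhd> y}" "q \<lhd> x (Suc n)"
      using approximate_below W(1) open_future open_Int by meson
    then show "\<exists>q. (q \<in> W (Suc n) \<and> q \<lhd> x (Suc n)) \<and> p \<lhd> q" by blast
  qed
  then obtain u where u: "\<And>n. u n \<in> W n" "\<And>n. u n \<lhd> x n" "\<And>n. u n \<lhd> u (Suc n)" by blast
  have "convergent u" by (rule complete[of u z]) (use u push_up x in blast)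
  then show ?thesis using that u unfolding convergent_def by blast
qed

text \<open>Follow the loop x, y, x, y, ... forever. The approximating sequence converges, yet
  shrinking neighbourhoods force its even terms to x and its odd terms to y.\<close>

lemma antisym:
  assumes "x \<unlhd> y" "y \<unlhd> x"
  shows "x = y"
proof -
  obtain A where A: "\<And>i. open (A i)" "\<And>i. x \<in> A i"
      "\<And>F. (\<forall>n. F n \<in> A n) \<Longrightarrow> F \<longlonglongrightarrow> x"
    by (rule first_countable_topology_class.countable_basis) blast
  obtain B where B: "\<And>i. open (B i)" "\<And>i. y \<in> B i"
      "\<And>F. (\<forall>n. F n \<in> B n) \<Longrightarrow> F \<longlonglongrightarrow> y"
    by (rule first_countable_topology_class.countable_basis) blast
  define v where "v n = (if even n then x else y)" for n :: nat
  \<comment> \<open>Halving the index lets the even and the odd terms each run through a full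
    neighbourhood basis.\<close>
  define W where "W n = (if even n then A (n div 2) else B (n div 2))" for n
  obtain u l where u: "\<And>n. u n \<in> W n" "u \<longlonglongrightarrow> l"
  proof (rule approximating_sequence[of v x W])
    show "v n \<unlhd> v (Suc n)" "v n \<unlhd> x" for n using assms by (simp_all add: v_def)
    show "open (W n)" "v n \<in> W n" for n using A(1,2) B(1,2) by (simp_all add: v_def W_def)
  qed blast
  have even: "(\<lambda>n. u (2 * n)) \<longlonglongrightarrow> x"
  proof (rule A(3), intro allI)
    fix n show "u (2 * n) \<in> A n" using u(1)[of "2*n"] by (simp add: W_def)
  qed
  have odd: "(\<lambda>n. u (2 * n + 1)) \<longlonglongrightarrow> y"
  proof (rule B(3), intro allI)
    fix n show "u (2 * n + 1) \<in> B n" using u(1)[of "2*n+1"] by (simp add: W_def)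
  qed
  have "(\<lambda>n. u (2 * n)) \<longlonglongrightarrow> l" "(\<lambda>n. u (2 * n + 1)) \<longlonglongrightarrow> l"
    using LIMSEQ_subseq_LIMSEQ[OF u(2), of "\<lambda>n. 2 * n"] LIMSEQ_subseq_LIMSEQ[OF u(2), of "\<lambda>n. 2 * n + 1"]
    by (auto simp: strict_mono_def comp_def)
  then show ?thesis using LIMSEQ_unique[OF even] LIMSEQ_unique[OF odd] by simp
qed

text \<open>\<open>z\<close> is already an upper bound; the point is that \<open>l\<close> is also a
  limit of points \<open>u n \<lhd> x n\<close>, so it stays in every closed set containing these.
  To obtain \<open>x m \<unlhd> l\<close>, each \<open>x m\<close> is approximated from below by
  \<open>p m k\<close>, and every \<open>p m k\<close> is eventually below
  \<open>u n\<close>.\<close>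

lemma increasing_sequence_bound:
  assumes x: "\<And>n. x n \<unlhd> x (Suc n)" "\<And>n. x n \<unlhd> z"
  obtains u l where "\<And>n. u n \<lhd> x n" "u \<longlonglongrightarrow> l" "\<And>n. x n \<unlhd> l"
proof -
  have mono: "x m \<unlhd> x n" if "m \<le> n" for m n
    using that by (induction rule: dec_induct) (auto intro: le_trans x)
  have "\<exists>p. (\<forall>k. p k \<lhd> x m) \<and> p \<longlonglongrightarrow> x m" for m
  proof -
    obtain A where A: "\<And>i. open (A i)" "\<And>i. x m \<in> A i"
        "\<And>F. (\<forall>n. F n \<in> A n) \<Longrightarrow> F \<longlonglongrightarrow> x m"
      by (rule first_countable_topology_class.countable_basis) blast
    have "\<forall>k. \<exists>q. q \<in> A k \<and> q \<lhd> x m" using approximate_below[OF A(2,1)] by blast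
    then show ?thesis using A(3) by metis
  qed
  then obtain p where p: "\<And>m k. p m k \<lhd> x m" "\<And>m. p m \<longlonglongrightarrow> x m" by metis
  \<comment> \<open>At stage \<open>n\<close> only finitely many futures are intersected, so
    \<open>W n\<close> is open; it contains \<open>x n\<close> by \<open>push_up\<close>.\<close>
  define W where "W n = (\<Inter>m\<le>n. \<Inter>k\<le>n. {y. p m k \<lhd> y})" for n :: nat
  obtain u l where u: "\<And>n. u n \<in> W n" "\<And>n. u n \<lhd> x n" "u \<longlonglongrightarrow> l"
  proof (rule approximating_sequence[of x z W])
    show "open (W n)" for n unfolding W_def by (intro open_INT ballI finite_atMost open_future)
    show "x n \<in> W n" for n unfolding W_def using push_up[OF p(1) mono] by blast
  qed (use x in auto)
  have "p m k \<unlhd> l" for m k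
  proof -
    have "p m k \<unlhd> u n" if "n \<ge> max m k" for n
      using u(1)[of n] that ll_imp_le by (auto simp: W_def)
    then have "eventually (\<lambda>n. u n \<in> {y. p m k \<unlhd> y}) sequentially"
      by (auto simp: eventually_sequentially intro!: exI[of _ "max m k"])
    then show ?thesis using Lim_in_closed_set[OF closed_future _ _ u(3)] by auto
  qed
  then have "x m \<unlhd> l" for m
    using le_limit[OF p(2) tendsto_const] by blast
  then show ?thesis using that u by blast
qed

lemma compact_diamond: "compact {z. x \<unlhd> z \<and> z \<unlhd> y}"
proof -
  have closed: "closed {z. x \<unlhd> z \<and> z \<unlhd> y}"
    using closed_Int[OF closed_future closed_past] by (simp add: Collect_conj_eq)
  have "seq_compact {z. x \<unlhd> z \<and> z \<unlhd> y}"
    unfolding seq_compact_def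
  proof (intro allI impI, rule ccontr)
    fix z :: "nat \<Rightarrow> 'a"
    assume z: "\<forall>n. z n \<in> {z. x \<unlhd> z \<and> z \<unlhd> y}"
      and no_limit: "\<not> (\<exists>l\<in>{z. x \<unlhd> z \<and> z \<unlhd> y}. \<exists>r. strict_mono r \<and> (z \<circ> r) \<longlonglongrightarrow> l)"
    \<comment> \<open>The upper limit of the pasts of the \<open>z n\<close>. Taking the closure
      tail by tail makes \<open>L\<close> closed.\<close>
    define L where "L = (\<Inter>N. closure (\<Union>n\<in>{N..}. {p. p \<unlhd> z n}))"
    define A where "A = {w\<in>L. x \<unlhd> w}"
    have x_A: "x \<in> A"
      using z unfolding A_def L_def by (auto intro!: subsetD[OF closure_subset])
    have A_y: "w \<unlhd> y" if "w \<in> A" for w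
    proof -
      have "closure (\<Union>n\<in>{0..}. {p. p \<unlhd> z n}) \<subseteq> {p. p \<unlhd> y}"
        by (rule closure_minimal[OF _ closed_past]) (use z in \<open>auto intro: le_trans\<close>)
      then show ?thesis using that unfolding A_def L_def by blast
    qed
    \<comment> \<open>Openness of the future of \<open>p\<close> absorbs the closure: it is a
      neighbourhood of \<open>w\<close>, so it contains points below late \<open>z n\<close>. The
      argument needs \<lhd>, which is why \<open>increasing_sequence_bound\<close> supplies
      \<open>u n \<lhd> c n\<close>.\<close>
    have L_below: "p \<in> L" if "p \<lhd> w" "w \<in> L" for p w
      unfolding L_def
    proof (intro INT_I subsetD[OF closure_subset])
      fix N
      have "w \<in> closure (\<Union>n\<in>{N..}. {p. p \<unlhd> z n})" using that unfolding L_def by blast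
      then have "{y. p \<lhd> y} \<inter> (\<Union>n\<in>{N..}. {p. p \<unlhd> z n}) \<noteq> {}"
        using open_Int_closure_eq_empty[OF open_future] that(1) by blast
      then obtain q n where "n \<ge> N" "q \<unlhd> z n" "p \<lhd> q" by auto
      then show "p \<in> (\<Union>n\<in>{N..}. {p. p \<unlhd> z n})"
        using push_up ll_imp_le by (intro UN_I[of n]) auto
    qed
    have closed_L: "closed L" unfolding L_def by auto
    have sequence_bound: "\<exists>l\<in>A. \<forall>n. c n \<unlhd> l" if c: "\<And>n. c n \<unlhd> c (Suc n)" "\<And>n. c n \<in> A" for c
    proof -
      obtain u l where u: "\<And>n. u n \<lhd> c n" "u \<longlonglongrightarrow> l" "\<And>n. c n \<unlhd> l"
        by (rule increasing_sequence_bound[of c y]) (use c A_y in auto)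
      have "u n \<in> L" for n using L_below u(1) c(2) unfolding A_def by blast
      then have "l \<in> L" by (rule closed_sequentially[OF closed_L _ u(2)])
      moreover have "x \<unlhd> l" using c(2)[of 0] u(3)[of 0] le_trans unfolding A_def by blast
      ultimately show ?thesis using u(3) unfolding A_def by blast
    qed
    \<comment> \<open>Zorn's lemma asks for bounds of chains of any size. A bound of a countable
      dense subset suffices: the past of that bound is closed, so it contains the rest of the
      chain.\<close>
    have chain_bound: "\<exists>l\<in>A. \<forall>c\<in>C. c \<unlhd> l" if C: "C \<in> Chains (relation_of (\<unlhd>) A)" for C
    proof (cases "C = {}")
      case False
      have CA: "C \<subseteq> A" and total: "\<And>a b. a \<in> C \<Longrightarrow> b \<in> C \<Longrightarrow> a \<unlhd> b \<or> b \<unlhd> a"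
        using C unfolding Chains_def relation_of_def by auto
      obtain \<B> :: "'a set set" where \<B>: "countable \<B>" "topological_basis \<B>"
        using ex_countable_basis by blast
      define D where "D = (\<lambda>B. SOME d. d \<in> B \<inter> C) ` {B\<in>\<B>. B \<inter> C \<noteq> {}}"
      have some: "(SOME d. d \<in> B \<inter> C) \<in> B \<inter> C" if "B \<inter> C \<noteq> {}" for B
        using that by (metis some_in_eq)
      have D: "D \<subseteq> C" "countable D" using some \<B>(1) unfolding D_def by auto
      have dense: "C \<subseteq> closure D"
      proof
        fix c assume c: "c \<in> C"
        show "c \<in> closure D" unfolding closure_iff_nhds_not_empty
        proof (intro allI impI)
          fix W V assume W: "V \<subseteq> W" "open V" "c \<in> V"
          obtain B where B: "B \<in> \<B>" "c \<in> B" "B \<subseteq> V"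
            using topological_basisE[OF \<B>(2) W(2,3)] by blast
          then have "B \<inter> C \<noteq> {}" using c by blast
          then have "(SOME d. d \<in> B \<inter> C) \<in> D \<inter> W" using B some[of B] W unfolding D_def by blast
          then show "D \<inter> W \<noteq> {}" by blast
        qed
      qed
      have "D \<noteq> {}" using dense False by auto
      define d where "d = from_nat_into D"
      have d: "range d = D"
        unfolding d_def by (rule range_from_nat_into[OF \<open>D \<noteq> {}\<close> D(2)])
      have dC: "d n \<in> C" for n using d D by blast
      \<comment> \<open>A running maximum along the enumeration \<open>d\<close>; totality of the
        chain makes it dominate every \<open>d n\<close>.\<close>
      define c where "c = rec_nat (d 0) (\<lambda>n a. if a \<unlhd> d (Suc n) then d (Suc n) else a)"
      have c_simps: "c 0 = d 0" "\<And>n. c (Suc n) = (if c n \<unlhd> d (Suc n) then d (Suc n) else c n)"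
        unfolding c_def by auto
      have cC: "c n \<in> C" for n by (induction n) (auto simp: c_simps dC)
      have dc: "d n \<unlhd> c n" for n
        using total[OF cC dC] by (cases n) (auto simp: c_simps)
      have "c n \<unlhd> c (Suc n)" for n by (simp add: c_simps)
      then obtain l where l: "l \<in> A" "\<And>n. c n \<unlhd> l"
        using sequence_bound[of c] cC CA by blast
      have "D \<subseteq> {p. p \<unlhd> l}" using d dc l le_trans by blast
      then have "closure D \<subseteq> {p. p \<unlhd> l}" by (rule closure_minimal[OF _ closed_past])
      then show ?thesis using dense l(1) by blast
    qed (use x_A in auto)
    have "partial_order_on A (relation_of (\<unlhd>) A)"
      by (rule partial_order_on_relation_ofI) (auto intro: le_trans antisym)
    from predicate_Zorn[OF this chain_bound]
    obtain w where w: "w \<in> A" "\<And>a. a \<in> A \<Longrightarrow> w \<unlhd> a \<Longrightarrow> a = w" by blast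
    obtain U where U: "compact U" "w \<in> interior U" using compact_nhd by blast
    \<comment> \<open>Otherwise compactness of \<open>U\<close> would yield the convergent
      subsequence assumed not to exist, its limit staying in the closed diamond.\<close>
    have "\<exists>N. \<forall>n\<ge>N. z n \<notin> U"
    proof (rule ccontr)
      assume "\<not> ?thesis"
      then have "infinite {n. z n \<in> U}"
        unfolding infinite_nat_iff_unbounded_le by auto
      then obtain r :: "nat \<Rightarrow> nat" where r: "strict_mono r" "\<And>n. z (r n) \<in> U"
        using infinite_enumerate[of "{n. z n \<in> U}"] by blast
      have "seq_compact U" using U(1) by (rule compact_imp_seq_compact)
      then obtain l s where s: "strict_mono s" "((z \<circ> r) \<circ> s) \<longlonglongrightarrow> l"
        using r(2) seq_compactE[of U "z \<circ> r"] by (metis comp_apply)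
      moreover have "l \<in> {z. x \<unlhd> z \<and> z \<unlhd> y}"
        by (rule closed_sequentially[OF closed _ s(2)]) (use z in auto)
      moreover have "strict_mono (r \<circ> s)" using r(1) s(1) by (rule strict_mono_o)
      ultimately show False using no_limit by (metis comp_assoc)
    qed
    then obtain N where N: "\<And>n. n \<ge> N \<Longrightarrow> z n \<notin> U" by blast
    obtain B where B: "\<And>i. open (B i)" "\<And>i. w \<in> B i" "\<And>F. (\<forall>n. F n \<in> B n) \<Longrightarrow> F \<longlonglongrightarrow> w"
      by (rule first_countable_topology_class.countable_basis) blast
    have "\<forall>k. \<exists>p q n. p \<in> B k \<and> q \<in> frontier U \<and> n \<ge> k \<and> p \<unlhd> q \<and> q \<unlhd> z n"
    proof
      fix k
      \<comment> \<open>From \<open>N\<close> on the target \<open>z n\<close> lies outside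
        \<open>U\<close>, so an exit point exists; an index of at least \<open>k\<close> is what
        later puts the limit of the exit points into \<open>L\<close>.\<close>
      have "w \<in> closure (\<Union>n\<in>{max N k..}. {p. p \<unlhd> z n})" using w(1) unfolding A_def L_def by blast
      moreover have "w \<in> B k \<inter> interior U" "open (B k \<inter> interior U)" using B U by auto
      ultimately have "(B k \<inter> interior U) \<inter> (\<Union>n\<in>{max N k..}. {p. p \<unlhd> z n}) \<noteq> {}"
        using open_Int_closure_eq_empty by blast
      then obtain p n where p: "p \<in> B k \<inter> interior U" "n \<in> {max N k..}" "p \<unlhd> z n" by blast
      then obtain q where "q \<in> frontier U" "p \<unlhd> q" "q \<unlhd> z n"
        using frontier_crossing[of p "z n" U] N[of n] interior_subset by auto
      then show "\<exists>p q n. p \<in> B k \<and> q \<in> frontier U \<and> n \<ge> k \<and> p \<unlhd> q \<and> q \<unlhd> z n"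
        using p by auto
    qed
    then obtain p q m where pqm: "\<And>k. p k \<in> B k" "\<And>k. q k \<in> frontier U" "\<And>k. m k \<ge> k"
        "\<And>k. p k \<unlhd> q k" "\<And>k. q k \<unlhd> z (m k)"
      by metis
    have "frontier U \<subseteq> U"
      by (intro frontier_subset_closed compact_imp_closed U)
    then have "seq_compact (frontier U)"
      using compact_Int_closed[OF U(1) frontier_closed, of U]
      by (simp add: compact_imp_seq_compact inf.absorb2)
    then obtain l r where l: "l \<in> frontier U" "strict_mono r" "(q \<circ> r) \<longlonglongrightarrow> l"
      using pqm(2) seq_compactE[of "frontier U" q] by metis
    have "(p \<circ> r) \<longlonglongrightarrow> w" by (rule LIMSEQ_subseq_LIMSEQ[OF B(3) l(2)]) (use pqm in auto)
    then have wl: "w \<unlhd> l" by (rule le_limit[OF _ l(3)]) (use pqm in auto)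
    have "l \<in> L" unfolding L_def
    proof
      fix K
      have "eventually (\<lambda>k. (q \<circ> r) k \<in> closure (\<Union>n\<in>{K..}. {p. p \<unlhd> z n})) sequentially"
        unfolding eventually_sequentially
      proof (intro exI[of _ K] allI impI)
        fix k assume "K \<le> k"
        then have "K \<le> m (r k)" using pqm(3)[of "r k"] seq_suble[OF l(2), of k] by linarith
        then show "(q \<circ> r) k \<in> closure (\<Union>n\<in>{K..}. {p. p \<unlhd> z n})"
          using pqm(5)[of "r k"] by (auto intro!: subsetD[OF closure_subset])
      qed
      then show "l \<in> closure (\<Union>n\<in>{K..}. {p. p \<unlhd> z n})"
        using Lim_in_closed_set[OF closed_closure _ _ l(3)] by auto
    qed
    then have "l \<in> A" using wl w(1) le_trans unfolding A_def by blast
    then have "l = w" using w(2) wl by blast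
    then show False using l(1) U(2) by (simp add: frontier_def)
  qed
  then show ?thesis by (simp add: seq_compact_eq_compact)
qed

end

section \<open>Concatenation of curves\<close>

text \<open>One lemma covers restriction to a subinterval (\<sigma> = 1, k = 0), translation for
  concatenation (\<sigma> = 1), and reversal of the parameter (\<sigma> = -1). In the last case
  velocities change sign and the time orientation flips, hence two structures with a common atlas
  and two velocity conditions.\<close>

lemma C1_curve_on_affine:
  fixes \<sigma> k :: real
  assumes \<gamma>: "C1_curve_on M P S \<gamma>" and atlas: "atlas N = atlas M"
    and sub: "(\<lambda>t. \<sigma> * t + k) ` T \<subseteq> S"
    and PQ: "\<And>c x v. c \<in> atlas M \<Longrightarrow> x \<in> chart_dom c \<Longrightarrow> P c x v \<Longrightarrow> Q c x (\<sigma> *\<^sub>R v)"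
  shows "C1_curve_on N Q T (\<lambda>t. \<gamma> (\<sigma> * t + k))"
  unfolding C1_curve_on_def atlas
proof (intro conjI ballI)
  let ?r = "\<lambda>t. \<sigma> * t + k"
  have r: "continuous_on A ?r" for A by (intro continuous_intros)
  show "continuous_on T (\<lambda>t. \<gamma> (?r t))"
    using continuous_on_compose2[OF _ r sub] \<gamma> unfolding C1_curve_on_def by blast
  fix c assume c: "c \<in> atlas M"
  then obtain \<gamma>' where \<gamma>': "continuous_on {t\<in>S. \<gamma> t \<in> chart_dom c} \<gamma>'"
    "\<And>t. t \<in> S \<Longrightarrow> \<gamma> t \<in> chart_dom c \<Longrightarrow>
        ((chart_map c \<circ> \<gamma>) has_vector_derivative \<gamma>' t) (at t within S) \<and> P c (\<gamma> t) (\<gamma>' t)"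
    using \<gamma> unfolding C1_curve_on_def by blast
  show "\<exists>\<gamma>'. continuous_on {t\<in>T. \<gamma> (?r t) \<in> chart_dom c} \<gamma>' \<and>
        (\<forall>t\<in>T. \<gamma> (?r t) \<in> chart_dom c \<longrightarrow>
           ((chart_map c \<circ> (\<lambda>t. \<gamma> (?r t))) has_vector_derivative \<gamma>' t) (at t within T) \<and>
           Q c (\<gamma> (?r t)) (\<gamma>' t))"
  proof (intro exI[of _ "\<lambda>t. \<sigma> *\<^sub>R \<gamma>' (?r t)"] conjI ballI impI)
    show "continuous_on {t\<in>T. \<gamma> (?r t) \<in> chart_dom c} (\<lambda>t. \<sigma> *\<^sub>R \<gamma>' (?r t))"
      by (intro continuous_on_scaleR continuous_on_const continuous_on_compose2[OF \<gamma>'(1) r])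
        (use sub in auto)
    fix t assume t: "t \<in> T" "\<gamma> (?r t) \<in> chart_dom c"
    then have rt: "?r t \<in> S" using sub by blast
    have "(?r has_vector_derivative \<sigma>) (at t within T)"
      by (auto intro!: derivative_eq_intros simp: has_real_derivative_iff_has_vector_derivative[symmetric])
    then show "((chart_map c \<circ> (\<lambda>t. \<gamma> (?r t))) has_vector_derivative \<sigma> *\<^sub>R \<gamma>' (?r t)) (at t within T)"
      using vector_diff_chain_within[of ?r \<sigma> t T "chart_map c \<circ> \<gamma>" "\<gamma>' (?r t)"]
        has_vector_derivative_within_subset[OF conjunct1[OF \<gamma>'(2)[OF rt t(2)]] sub]
      by (simp add: comp_def)
    show "Q c (\<gamma> (?r t)) (\<sigma> *\<^sub>R \<gamma>' (?r t))" using \<gamma>'(2)[OF rt t(2)] PQ c t by blast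
  qed
qed

lemma C1_curve_on_mono:
  assumes "C1_curve_on M P S \<gamma>" "T \<subseteq> S"
    and "\<And>c x v. c \<in> atlas M \<Longrightarrow> x \<in> chart_dom c \<Longrightarrow> P c x v \<Longrightarrow> Q c x v"
  shows "C1_curve_on M Q T \<gamma>"
  using C1_curve_on_affine[of M P S \<gamma> M 1 0 T Q] assms by simp

lemma C1_curve_on_cong:
  assumes "C1_curve_on M P S \<gamma>" and eq: "\<And>t. t \<in> S \<Longrightarrow> \<delta> t = \<gamma> t"
  shows "C1_curve_on M P S \<delta>"
  unfolding C1_curve_on_def
proof (intro conjI ballI)
  show "continuous_on S \<delta>"
    using assms unfolding C1_curve_on_def by (metis continuous_on_cong)
  fix c assume "c \<in> atlas M"
  then obtain \<gamma>' where \<gamma>': "continuous_on {t\<in>S. \<gamma> t \<in> chart_dom c} \<gamma>'"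
    "\<And>t. t \<in> S \<Longrightarrow> \<gamma> t \<in> chart_dom c \<Longrightarrow>
        ((chart_map c \<circ> \<gamma>) has_vector_derivative \<gamma>' t) (at t within S) \<and> P c (\<gamma> t) (\<gamma>' t)"
    using assms(1) unfolding C1_curve_on_def by blast
  show "\<exists>\<gamma>'. continuous_on {t\<in>S. \<delta> t \<in> chart_dom c} \<gamma>' \<and>
        (\<forall>t\<in>S. \<delta> t \<in> chart_dom c \<longrightarrow>
           ((chart_map c \<circ> \<delta>) has_vector_derivative \<gamma>' t) (at t within S) \<and> P c (\<delta> t) (\<gamma>' t))"
  proof (intro exI[of _ \<gamma>'] conjI ballI impI)
    have "{t\<in>S. \<delta> t \<in> chart_dom c} = {t\<in>S. \<gamma> t \<in> chart_dom c}" using eq by auto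
    then show "continuous_on {t\<in>S. \<delta> t \<in> chart_dom c} \<gamma>'" using \<gamma>'(1) by simp
    fix t assume t: "t \<in> S" "\<delta> t \<in> chart_dom c"
    then have *: "((chart_map c \<circ> \<gamma>) has_vector_derivative \<gamma>' t) (at t within S)" "P c (\<delta> t) (\<gamma>' t)"
      using \<gamma>'(2)[of t] eq by auto
    show "((chart_map c \<circ> \<delta>) has_vector_derivative \<gamma>' t) (at t within S)"
      by (rule has_vector_derivative_transform[OF t(1) _ *(1)]) (use eq in auto)
    show "P c (\<delta> t) (\<gamma>' t)" by fact
  qed
qed

text \<open>Keeping only the endpoints of a single C1 piece turns concatenation into transitive
  closure, so that later arguments induct on pieces instead of handling partitions.\<close>

definition curve_step ::
  "('a::topological_space, 'e::euclidean_space) lorentz_structure \<Rightarrow>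
   (('a, 'e) chart \<Rightarrow> 'a \<Rightarrow> 'e \<Rightarrow> bool) \<Rightarrow> 'a \<Rightarrow> 'a \<Rightarrow> bool" where
  "curve_step M P x y \<longleftrightarrow>
     (\<exists>a b \<gamma>. a < b \<and> C1_curve_on M P {a..b} \<gamma> \<and> \<gamma> a = x \<and> \<gamma> b = y)"

lemma curve_stepI:
  "C1_curve_on M P {a..b} \<gamma> \<Longrightarrow> a < b \<Longrightarrow> curve_step M P (\<gamma> a) (\<gamma> b)"
  unfolding curve_step_def by blast

lemma curve_step_subinterval:
  assumes "C1_curve_on M P {a..b} \<gamma>" "a \<le> s" "s < t" "t \<le> b"
  shows "curve_step M P (\<gamma> s) (\<gamma> t)"
  by (rule curve_stepI[OF C1_curve_on_mono[OF assms(1)]]) (use assms in auto)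

lemma piecewise_C1_curve_iff_tranclp:
  "(\<exists>a b \<gamma>. piecewise_C1_curve M P a b \<gamma> \<and> \<gamma> a = x \<and> \<gamma> b = y) \<longleftrightarrow> (curve_step M P)\<^sup>+\<^sup>+ x y"
proof
  assume "\<exists>a b \<gamma>. piecewise_C1_curve M P a b \<gamma> \<and> \<gamma> a = x \<and> \<gamma> b = y"
  then obtain \<gamma> n s where n: "n > 0" "\<gamma> (s 0) = x" "\<gamma> (s n) = y"
    and s: "\<And>i. i < n \<Longrightarrow> s i < s (Suc i) \<and> C1_curve_on M P {s i..s (Suc i)} \<gamma>"
    unfolding piecewise_C1_curve_def by blast
  have "(curve_step M P)\<^sup>+\<^sup>+ (\<gamma> (s 0)) (\<gamma> (s (Suc i)))" if "i < n" for i
    using that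
  proof (induction i)
    case 0
    then show ?case using curve_stepI s by blast
  next
    case (Suc i)
    then show ?case using curve_stepI[of M P "s (Suc i)"] s[of "Suc i"]
      by (meson Suc_lessD tranclp.trancl_into_trancl)
  qed
  from this[of "n - 1"] show "(curve_step M P)\<^sup>+\<^sup>+ x y" using n by simp
next
  assume "(curve_step M P)\<^sup>+\<^sup>+ x y"
  then show "\<exists>a b \<gamma>. piecewise_C1_curve M P a b \<gamma> \<and> \<gamma> a = x \<and> \<gamma> b = y"
  proof (induction rule: tranclp_induct)
    case (base y)
    then obtain a b \<gamma> where \<gamma>: "a < b" "C1_curve_on M P {a..b} \<gamma>" "\<gamma> a = x" "\<gamma> b = y"
      unfolding curve_step_def by blast
    have "piecewise_C1_curve M P a b \<gamma>"
      unfolding piecewise_C1_curve_def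
      by (rule exI[of _ 1], rule exI[of _ "\<lambda>i. if i = 0 then a else b"]) (use \<gamma> in auto)
    then show ?case using \<gamma> by blast
  next
    case (step y z)
    then obtain a b \<gamma> where \<gamma>: "piecewise_C1_curve M P a b \<gamma>" "\<gamma> a = x" "\<gamma> b = y" by blast
    then obtain n s where n: "n > 0" "s 0 = a" "s n = b"
      and s: "\<And>i. i < n \<Longrightarrow> s i < s (Suc i) \<and> C1_curve_on M P {s i..s (Suc i)} \<gamma>"
      unfolding piecewise_C1_curve_def by blast
    obtain c d \<delta> where \<delta>: "c < d" "C1_curve_on M P {c..d} \<delta>" "\<delta> c = y" "\<delta> d = z"
      using step(2) unfolding curve_step_def by blast
    \<comment> \<open>The new piece is \<open>\<delta>\<close> translated to start at
      \<open>b\<close>. At \<open>b\<close> itself the first branch applies, and both branches agree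
      there because \<open>\<gamma> b = \<delta> c\<close>. Velocities need not match, as corners
      are allowed. The factor \<open>1\<close> fits the form of
      \<open>C1_curve_on_affine\<close>.\<close>
    define \<eta> where "\<eta> t = (if t \<le> b then \<gamma> t else \<delta> (1 * t + (c - b)))" for t
    define s' where "s' i = (if i \<le> n then s i else b + (d - c))" for i
    have le: "s (Suc i) \<le> b" if "i < n" for i
    proof -
      have "s (Suc i) \<le> s m" if "Suc i \<le> m" "m \<le> n" for m
        using that by (induction m rule: dec_induct) (use s in \<open>auto simp: Suc_le_eq intro: order_trans less_imp_le\<close>)
      from this[of n] that n show ?thesis by simp
    qed
    have "a \<le> b" using le[of 0] s[of 0] n by auto
    have 1: "C1_curve_on M P {s i..s (Suc i)} \<eta>" if "i < n" for i
      by (rule C1_curve_on_cong[of _ _ _ \<gamma>]) (use s[OF that] le[OF that] in \<open>auto simp: \<eta>_def\<close>)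
    have 2: "C1_curve_on M P {b..b + (d - c)} \<eta>"
    proof (rule C1_curve_on_cong)
      show "C1_curve_on M P {b..b + (d - c)} (\<lambda>t. \<delta> (1 * t + (c - b)))"
        by (rule C1_curve_on_affine[OF \<delta>(2)]) auto
    qed (use \<gamma> \<delta> in \<open>auto simp: \<eta>_def\<close>)
    have "piecewise_C1_curve M P a (b + (d - c)) \<eta>"
      unfolding piecewise_C1_curve_def
    proof (intro exI[of _ "Suc n"] exI[of _ s'] conjI allI impI)
      fix i assume i: "i < Suc n"
      show "s' i < s' (Suc i)" using i s[of i] n \<delta>(1) by (auto simp: s'_def less_Suc_eq)
      show "C1_curve_on M P {s' i..s' (Suc i)} \<eta>" using i 1[of i] 2 n by (auto simp: s'_def less_Suc_eq)
    qed (auto simp: s'_def n)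
    moreover have "\<eta> a = x" "\<eta> (b + (d - c)) = z" using \<open>a \<le> b\<close> \<gamma> \<delta> by (auto simp: \<eta>_def)
    ultimately show ?case by blast
  qed
qed

lemma timelike_rel_iff_tranclp: "x \<lless>\<^bsub>M\<^esub> y \<longleftrightarrow> (curve_step M (future_timelike M))\<^sup>+\<^sup>+ x y"
  unfolding timelike_rel_def timelike_curve_def piecewise_C1_curve_iff_tranclp ..

lemma causal_rel_iff_rtranclp: "x \<preceq>\<^bsub>M\<^esub> y \<longleftrightarrow> (curve_step M (future_causal M))\<^sup>*\<^sup>* x y"
  unfolding causal_rel_def causal_curve_def piecewise_C1_curve_iff_tranclp
  by (auto dest: rtranclpD intro: tranclp_into_rtranclp)

lemma causal_iff_acyclic: "causal M \<longleftrightarrow> (\<forall>x. \<not> (curve_step M (future_causal M))\<^sup>+\<^sup>+ x x)"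
  unfolding causal_def causal_curve_def piecewise_C1_curve_iff_tranclp[symmetric] by metis

lemma causal_rel_trans: "x \<preceq>\<^bsub>M\<^esub> y \<Longrightarrow> y \<preceq>\<^bsub>M\<^esub> z \<Longrightarrow> x \<preceq>\<^bsub>M\<^esub> z"
  unfolding causal_rel_iff_rtranclp by (rule rtranclp_trans)

lemma timelike_rel_trans: "x \<lless>\<^bsub>M\<^esub> y \<Longrightarrow> y \<lless>\<^bsub>M\<^esub> z \<Longrightarrow> x \<lless>\<^bsub>M\<^esub> z"
  unfolding timelike_rel_iff_tranclp by (rule tranclp_trans)

text \<open>The induction finds a piece that starts in \<open>U\<close> and ends outside; its image
  is connected and so meets the frontier.\<close>

lemma causal_rel_frontier_crossing:
  assumes "x \<preceq>\<^bsub>M\<^esub> y" "x \<in> U" "y \<notin> U"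
  shows "\<exists>q\<in>frontier U. x \<preceq>\<^bsub>M\<^esub> q \<and> q \<preceq>\<^bsub>M\<^esub> y"
  using assms(1) assms(3) unfolding causal_rel_iff_rtranclp
proof (induction rule: rtranclp_induct)
  case base
  then show ?case using assms(2) by blast
next
  case (step y z)
  show ?case
  proof (cases "y \<in> U")
    case False
    then show ?thesis using step by (meson rtranclp.rtrancl_into_rtrancl)
  next
    case True
    obtain a b \<gamma> where \<gamma>: "a < b" "C1_curve_on M (future_causal M) {a..b} \<gamma>" "\<gamma> a = y" "\<gamma> b = z"
      using step(2) unfolding curve_step_def by blast
    have "connected (\<gamma> ` {a..b})"
      using \<gamma>(2) by (intro connected_continuous_image) (auto simp: C1_curve_on_def)
    moreover have "y \<in> \<gamma> ` {a..b}" "z \<in> \<gamma> ` {a..b}" using \<gamma> by auto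
    ultimately have "\<gamma> ` {a..b} \<inter> frontier U \<noteq> {}"
      using True step.prems by (intro connected_Int_frontier) auto
    then obtain t where t: "a \<le> t" "t \<le> b" "\<gamma> t \<in> frontier U" by auto
    have "(curve_step M (future_causal M))\<^sup>*\<^sup>* y (\<gamma> t)"
      using curve_step_subinterval[OF \<gamma>(2), of a t] \<gamma>(3) t by (cases "a = t") auto
    moreover have "(curve_step M (future_causal M))\<^sup>*\<^sup>* (\<gamma> t) z"
      using curve_step_subinterval[OF \<gamma>(2), of t b] \<gamma>(4) t by (cases "t = b") auto
    ultimately show ?thesis using t(3) step(1) by (meson rtranclp_trans)
  qed
qed

text \<open>The clause that needs an argument is v \<noteq> 0: a bilinear form vanishes at zero,
  whereas a timelike vector has negative square.\<close>

lemma timelike_imp_causal_rel: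
  assumes "lorentz_metric M" "x \<lless>\<^bsub>M\<^esub> y"
  shows "x \<preceq>\<^bsub>M\<^esub> y"
proof -
  have "future_causal M c x v" if "c \<in> atlas M" "x \<in> chart_dom c" "future_timelike M c x v" for c x v
  proof -
    have "bilinear (metric M c x)"
      using assms(1) that unfolding lorentz_metric_def lorentz_form_def by blast
    then show ?thesis
      using that(3) bilinear_lzero[of "metric M c x" v] unfolding future_timelike_def future_causal_def by auto
  qed
  then have "curve_step M (future_timelike M) x y \<longrightarrow> curve_step M (future_causal M) x y" for x y
    unfolding curve_step_def using C1_curve_on_mono[where M=M and P="future_timelike M" and Q="future_causal M"]
    by blast
  then show ?thesis
    using assms(2) mono_rtranclp[of "curve_step M (future_timelike M)"] tranclp_into_rtranclp
    unfolding timelike_rel_iff_tranclp causal_rel_iff_rtranclp by metis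
qed

section \<open>Timelike curves in coordinates\<close>

lemma bilinear_expansion:
  fixes b :: "'e::euclidean_space \<Rightarrow> 'e \<Rightarrow> real"
  assumes "bilinear b"
  shows "b u v = (\<Sum>i\<in>Basis. \<Sum>j\<in>Basis. (u \<bullet> i) * (v \<bullet> j) * b i j)"
proof -
  have "b u v = b (\<Sum>i\<in>Basis. (u \<bullet> i) *\<^sub>R i) (\<Sum>j\<in>Basis. (v \<bullet> j) *\<^sub>R j)"
    by (simp add: euclidean_representation)
  also have "\<dots> = (\<Sum>(i,j)\<in>Basis \<times> Basis. b ((u \<bullet> i) *\<^sub>R i) ((v \<bullet> j) *\<^sub>R j))"
    by (rule bilinear_sum[OF assms])
  finally show ?thesis
    by (simp add: sum.cartesian_product bilinear_lmul[OF assms] bilinear_rmul[OF assms] mult_ac)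
qed

text \<open>Metric components are given as continuous in the base point for fixed vectors only;
  expansion in a basis makes them jointly continuous in base point and vectors.\<close>

lemma continuous_on_bilinear_field:
  fixes G :: "'e::euclidean_space \<Rightarrow> 'e \<Rightarrow> 'e \<Rightarrow> real"
  assumes "\<And>y. y \<in> V \<Longrightarrow> bilinear (G y)" and "\<And>u v. continuous_on V (\<lambda>y. G y u v)"
    and "continuous_on D f" "f ` D \<subseteq> V" "continuous_on D u" "continuous_on D v"
  shows "continuous_on D (\<lambda>p. G (f p) (u p) (v p))"
proof -
  have "continuous_on D (\<lambda>p. \<Sum>i\<in>Basis. \<Sum>j\<in>Basis. (u p \<bullet> i) * (v p \<bullet> j) * G (f p) i j)"
    by (intro continuous_intros assms(5,6) continuous_on_compose2[OF assms(2,3,4)])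
  moreover have "(\<Sum>i\<in>Basis. \<Sum>j\<in>Basis. (u p \<bullet> i) * (v p \<bullet> j) * G (f p) i j) = G (f p) (u p) (v p)"
    if "p \<in> D" for p
    by (rule bilinear_expansion[OF assms(1), symmetric]) (use that assms(4) in auto)
  ultimately show ?thesis by (simp cong: continuous_on_cong)
qed

text \<open>By the tube lemma, compactness of \<open>K\<close> lets one \<open>e\<close> work for
  all \<open>t\<close>. In the applications \<open>w\<close> is the size of a perturbation and
  \<open>t\<close> the curve parameter, so an open condition on position and velocity survives small
  perturbations of the whole curve.\<close>

lemma continuous_family_stays_in_open:
  fixes f :: "'b::real_normed_vector \<times> 'c::topological_space \<Rightarrow> 'd::topological_space"
  assumes K: "compact K" and f: "continuous_on (UNIV \<times> K) f" and W: "open W"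
    and zero: "\<And>t. t \<in> K \<Longrightarrow> f (0, t) \<in> W"
  obtains e where "e > 0" "\<And>w t. norm w < e \<Longrightarrow> t \<in> K \<Longrightarrow> f (w, t) \<in> W"
proof -
  obtain A where A: "open A" "A \<inter> (UNIV \<times> K) = f -` W \<inter> (UNIV \<times> K)"
    using f W unfolding continuous_on_open_invariant by metis
  then have "{0} \<times> K \<subseteq> A" using zero by blast
  from Elementary_Topology.tube_lemma[OF K A(1) this] obtain X where X: "0 \<in> X" "open X" "X \<times> K \<subseteq> A" by blast
  then obtain e where e: "e > 0" "ball 0 e \<subseteq> X" using open_contains_ball by blast
  show ?thesis
  proof (rule that[OF e(1)])
    fix w :: 'b and t assume "norm w < e" "t \<in> K"
    then have "(w, t) \<in> A \<inter> (UNIV \<times> K)" using e X by auto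
    then show "f (w, t) \<in> W" using A(2) by blast
  qed
qed

lemma continuous_on_neighbourhood:
  fixes \<gamma> :: "real \<Rightarrow> 'a::topological_space"
  assumes "continuous_on S \<gamma>" "t \<in> S" "open U" "\<gamma> t \<in> U"
  obtains \<delta> where "\<delta> > 0" "\<And>s. s \<in> S \<Longrightarrow> \<bar>s - t\<bar> < \<delta> \<Longrightarrow> \<gamma> s \<in> U"
proof -
  obtain A where A: "open A" "A \<inter> S = \<gamma> -` U \<inter> S"
    using assms(1,3) unfolding continuous_on_open_invariant by metis
  then have "t \<in> A" using assms by blast
  then obtain e where "e > 0" "ball t e \<subseteq> A" using A(1) open_contains_ball by blast
  then show ?thesis using that[of e] A(2) by (auto simp: dist_real_def abs_minus_commute subset_iff)
qed

lemma smooth_on_continuous_on: "smooth_on S f \<Longrightarrow> continuous_on S f"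
  unfolding smooth_on_def by (metis Ck_on.simps(1))

lemma smooth_on_has_derivative:
  "smooth_on S f \<Longrightarrow> x \<in> S \<Longrightarrow> (f has_derivative frechet_derivative f (at x)) (at x)"
  unfolding smooth_on_def using Ck_on.simps(2)[of 0] frechet_derivative_works by blast

lemma smooth_on_continuous_on_derivative:
  "smooth_on S f \<Longrightarrow> continuous_on S (\<lambda>x. frechet_derivative f (at x) v)"
  unfolding smooth_on_def using Ck_on.simps(2)[of 0] Ck_on.simps(1) by blast

section \<open>Open cones and deformation of curves in a single chart\<close>

locale spacetime_chart =
  fixes M :: "('a::{t2_space, second_countable_topology}, 'e::euclidean_space) lorentz_structure"
    and c :: "('a, 'e) chart"
  assumes spacetime: "spacetime M" and chart: "c \<in> atlas M"
begin

definition V :: "'e set" where "V = chart_map c ` chart_dom c"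

definition g :: "'e \<Rightarrow> 'e \<Rightarrow> 'e \<Rightarrow> real" where "g y = metric M c (chart_inv c y)"

definition X :: "'e \<Rightarrow> 'e" where "X y = time_field M c (chart_inv c y)"

text \<open>The future timelike vectors over the chart, as pairs of position and velocity. With both
  in one set, being timelike is an open condition on the pair, which is what the perturbation
  arguments use.\<close>

definition timecone :: "('e \<times> 'e) set" where
  "timecone = {(y, v). y \<in> V \<and> g y v v < 0 \<and> g y (X y) v < 0}"

lemma is_chart: "is_chart c"
  using spacetime chart unfolding spacetime_def smooth_atlas_def by blast

lemma open_dom: "open (chart_dom c)" and open_V: "open V"
  using is_chart unfolding is_chart_def V_def by auto

lemma chart_homeomorphism: "homeomorphism (chart_dom c) V (chart_map c) (chart_inv c)"
  using is_chart unfolding is_chart_def V_def by auto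

lemma continuous_on_chart: "continuous_on (chart_dom c) (chart_map c)"
  and continuous_on_chart_inv: "continuous_on V (chart_inv c)"
  using chart_homeomorphism unfolding homeomorphism_def by auto

lemma chart_inv_chart [simp]: "x \<in> chart_dom c \<Longrightarrow> chart_inv c (chart_map c x) = x"
  and chart_chart_inv [simp]: "y \<in> V \<Longrightarrow> chart_map c (chart_inv c y) = y"
  and chart_in_V [simp]: "x \<in> chart_dom c \<Longrightarrow> chart_map c x \<in> V"
  and chart_inv_in_dom [simp]: "y \<in> V \<Longrightarrow> chart_inv c y \<in> chart_dom c"
  using chart_homeomorphism unfolding homeomorphism_def by auto

lemma open_chart_preimage: "open U \<Longrightarrow> open (chart_dom c \<inter> chart_map c -` U)"
  and open_chart_inv_preimage: "open W \<Longrightarrow> open (V \<inter> chart_inv c -` W)"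
  using continuous_open_preimage continuous_on_chart continuous_on_chart_inv open_dom open_V by blast+

lemma bilinear_g: "y \<in> V \<Longrightarrow> bilinear (g y)"
  and symmetric_g: "y \<in> V \<Longrightarrow> g y u v = g y v u"
  using spacetime chart chart_inv_in_dom
  unfolding spacetime_def lorentz_metric_def lorentz_form_def g_def by blast+

lemma smooth_g: "smooth_on V (\<lambda>y. g y u v)"
  using spacetime chart unfolding spacetime_def lorentz_metric_def g_def V_def by blast

lemma X_timelike: "y \<in> V \<Longrightarrow> g y (X y) (X y) < 0"
  using spacetime chart chart_inv_in_dom unfolding spacetime_def time_oriented_def g_def X_def by blast

lemma continuous_on_X: "continuous_on V X"
  unfolding X_def
proof (rule continuous_on_compose2[OF _ continuous_on_chart_inv])
  show "continuous_on (chart_dom c) (time_field M c)"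
    using spacetime chart unfolding spacetime_def time_oriented_def by blast
qed auto

lemmas continuous_on_g =
  continuous_on_bilinear_field[OF bilinear_g smooth_on_continuous_on[OF smooth_g]]

lemma open_timecone: "open timecone"
proof -
  have "continuous_on (V \<times> UNIV) (\<lambda>p. g (fst p) (snd p) (snd p))"
    "continuous_on (V \<times> UNIV) (\<lambda>p. g (fst p) (X (fst p)) (snd p))"
    by (auto intro!: continuous_on_g continuous_intros continuous_on_compose2[OF continuous_on_X])
  then have "open ((V \<times> UNIV) \<inter> (\<lambda>p. g (fst p) (snd p) (snd p)) -` {..<0} \<inter>
      ((V \<times> UNIV) \<inter> (\<lambda>p. g (fst p) (X (fst p)) (snd p)) -` {..<0}))"
    by (intro open_Int continuous_open_preimage open_Times open_V) auto
  moreover have "(V \<times> UNIV) \<inter> (\<lambda>p. g (fst p) (snd p) (snd p)) -` {..<0} \<inter>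
      ((V \<times> UNIV) \<inter> (\<lambda>p. g (fst p) (X (fst p)) (snd p)) -` {..<0}) = timecone"
    unfolding timecone_def by auto
  ultimately show ?thesis by simp
qed

lemma timecone_iff:
  assumes "x \<in> chart_dom c"
  shows "(chart_map c x, v) \<in> timecone \<longleftrightarrow> future_timelike M c x v"
  using assms unfolding timecone_def future_timelike_def g_def X_def by simp

lemma change_of_chart:
  assumes d: "d \<in> atlas M" and x: "x \<in> chart_dom c" "x \<in> chart_dom d"
    and v: "future_timelike M c x v"
  shows "future_timelike M d x (change_of_coords c d x v)"
proof -
  have "metric M c x u w = metric M d x (change_of_coords c d x u) (change_of_coords c d x w)" for u w
    using spacetime chart d x unfolding spacetime_def lorentz_metric_def by blast
  moreover have "time_field M d x = change_of_coords c d x (time_field M c x)"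
    using spacetime chart d x unfolding spacetime_def time_oriented_def by blast
  ultimately show ?thesis using v unfolding future_timelike_def by metis
qed

text \<open>Timelike curves are tested in every chart of the atlas, while curves are constructed in
  one. The chain rule for the transition map carries the velocity to the other chart, and invariance
  of metric and time field keeps it in the cone.\<close>

lemma timelike_curve_from_coordinates:
  assumes \<beta>: "\<And>t. t \<in> S \<Longrightarrow> (\<beta> has_vector_derivative \<beta>' t) (at t within S)"
    and \<beta>': "continuous_on S \<beta>'" and cone: "\<And>t. t \<in> S \<Longrightarrow> (\<beta> t, \<beta>' t) \<in> timecone"
  shows "C1_curve_on M (future_timelike M) S (\<lambda>t. chart_inv c (\<beta> t))"
  unfolding C1_curve_on_def
proof (intro conjI ballI)
  have cont: "continuous_on S \<beta>"
    using \<beta> by (meson continuous_on_eq_continuous_within has_vector_derivative_continuous)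
  have V: "\<beta> t \<in> V" if "t \<in> S" for t using cone[OF that] unfolding timecone_def by auto
  show "continuous_on S (\<lambda>t. chart_inv c (\<beta> t))"
    by (rule continuous_on_compose2[OF continuous_on_chart_inv cont]) (use V in auto)
  fix d assume d: "d \<in> atlas M"
  define F where "F = transition c d"
  define W where "W = chart_map c ` (chart_dom c \<inter> chart_dom d)"
  define S' where "S' = {t\<in>S. chart_inv c (\<beta> t) \<in> chart_dom d}"
  have F: "smooth_on W F"
    using spacetime chart d unfolding spacetime_def smooth_atlas_def F_def W_def by blast
  have W: "\<beta> t \<in> W" if "t \<in> S'" for t
  proof -
    have "chart_inv c (\<beta> t) \<in> chart_dom c \<inter> chart_dom d" "\<beta> t = chart_map c (chart_inv c (\<beta> t))"
      using that V unfolding S'_def by auto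
    then show ?thesis unfolding W_def by blast
  qed
  let ?\<delta> = "\<lambda>t. frechet_derivative F (at (\<beta> t)) (\<beta>' t)"
  \<comment> \<open>Smoothness gives continuity of the derivative in each fixed direction; expanding
    \<open>\<beta>' t\<close> in a basis reduces the moving direction to these.\<close>
  have expand: "?\<delta> t = (\<Sum>i\<in>Basis. (\<beta>' t \<bullet> i) *\<^sub>R frechet_derivative F (at (\<beta> t)) i)" if "t \<in> S'" for t
  proof -
    have lin: "linear (frechet_derivative F (at (\<beta> t)))"
      using smooth_on_has_derivative[OF F W[OF that]] has_derivative_linear by blast
    show ?thesis
      by (subst euclidean_representation[of "\<beta>' t", symmetric])
        (simp add: linear_sum[OF lin] linear_cmul[OF lin] del: euclidean_representation)
  qed
  show "\<exists>\<gamma>'. continuous_on {t\<in>S. chart_inv c (\<beta> t) \<in> chart_dom d} \<gamma>' \<and>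
     (\<forall>t\<in>S. chart_inv c (\<beta> t) \<in> chart_dom d \<longrightarrow>
        ((chart_map d \<circ> (\<lambda>t. chart_inv c (\<beta> t))) has_vector_derivative \<gamma>' t) (at t within S) \<and>
        future_timelike M d (chart_inv c (\<beta> t)) (\<gamma>' t))"
  proof (intro exI[of _ ?\<delta>] conjI ballI impI)
    have "continuous_on S' (\<lambda>t. \<Sum>i\<in>Basis. (\<beta>' t \<bullet> i) *\<^sub>R frechet_derivative F (at (\<beta> t)) i)"
      by (intro continuous_intros continuous_on_compose2[OF smooth_on_continuous_on_derivative[OF F]]
          continuous_on_subset[OF \<beta>'] continuous_on_subset[OF cont]) (use W in \<open>auto simp: S'_def\<close>)
    then show "continuous_on {t\<in>S. chart_inv c (\<beta> t) \<in> chart_dom d} ?\<delta>"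
      unfolding S'_def[symmetric] using expand by (simp cong: continuous_on_cong)
    fix t assume t: "t \<in> S" "chart_inv c (\<beta> t) \<in> chart_dom d"
    then have "t \<in> S'" unfolding S'_def by auto
    from vector_derivative_diff_chain_within[OF \<beta>[OF t(1)]
        has_derivative_at_withinI[OF smooth_on_has_derivative[OF F W[OF this]]]]
    show "((chart_map d \<circ> (\<lambda>t. chart_inv c (\<beta> t))) has_vector_derivative ?\<delta> t) (at t within S)"
      unfolding F_def transition_def by (simp add: comp_def)
    have "future_timelike M c (chart_inv c (\<beta> t)) (\<beta>' t)"
      using timecone_iff[of "chart_inv c (\<beta> t)"] V[OF t(1)] cone[OF t(1)] by simp
    from change_of_chart[OF d _ t(2) this]
    show "future_timelike M d (chart_inv c (\<beta> t)) (?\<delta> t)"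
      using V[OF t(1)] unfolding change_of_coords_def F_def by simp
  qed
qed

lemma C1_curve_in_coordinates:
  assumes \<gamma>: "C1_curve_on M P S \<gamma>" and S: "\<And>t. t \<in> S \<Longrightarrow> \<gamma> t \<in> chart_dom c"
  obtains \<alpha>' where "continuous_on S \<alpha>'"
    "\<And>t. t \<in> S \<Longrightarrow> ((\<lambda>t. chart_map c (\<gamma> t)) has_vector_derivative \<alpha>' t) (at t within S)"
    "\<And>t. t \<in> S \<Longrightarrow> P c (\<gamma> t) (\<alpha>' t)"
proof -
  have eq: "{t\<in>S. \<gamma> t \<in> chart_dom c} = S" using S by auto
  show ?thesis using \<gamma> chart that S unfolding C1_curve_on_def comp_def
    by (metis (no_types, lifting) eq)
qed

lemma curve_step_from_coordinates:
  assumes "s < t"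
    and "\<And>u. u \<in> {s..t} \<Longrightarrow> (\<beta> has_vector_derivative \<beta>' u) (at u within {s..t})"
    and "continuous_on {s..t} \<beta>'" "\<And>u. u \<in> {s..t} \<Longrightarrow> (\<beta> u, \<beta>' u) \<in> timecone"
  shows "curve_step M (future_timelike M) (chart_inv c (\<beta> s)) (chart_inv c (\<beta> t))"
  by (rule curve_stepI[OF timelike_curve_from_coordinates[OF assms(2-4)] assms(1)])

text \<open>The straight coordinate line whose direction is the value of the time field at the point
  is timelike near that point, because the cone is open.\<close>

lemma timelike_past_accumulates:
  assumes x: "x \<in> chart_dom c" and W: "open W" "x \<in> W"
  shows "\<exists>p\<in>W. curve_step M (future_timelike M) p x"
proof -
  define y where "y = chart_map c x"
  define T where "T = X y"
  have y: "y \<in> V" "chart_inv c y = x" using x by (auto simp: y_def)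
  define A where "A = (\<lambda>t::real. (y + t *\<^sub>R T, T)) -` timecone \<inter>
    (\<lambda>t. y + t *\<^sub>R T) -` (V \<inter> chart_inv c -` W)"
  have "open A" unfolding A_def
    by (intro open_Int open_vimage open_timecone open_chart_inv_preimage W continuous_intros)
  moreover have "0 \<in> A"
    using y W(2) X_timelike[OF y(1)] unfolding A_def timecone_def T_def by simp
  ultimately obtain e where e: "e > 0" "ball 0 e \<subseteq> A" using open_contains_ball by blast
  have "t \<in> A" if "t \<in> {-e/2..0}" for t
    by (rule subsetD[OF e(2)]) (use that e(1) in \<open>auto simp: dist_real_def\<close>)
  then have t: "(y + t *\<^sub>R T, T) \<in> timecone" "chart_inv c (y + t *\<^sub>R T) \<in> W" if "t \<in> {-e/2..0}" for t
    using that unfolding A_def by auto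
  have "curve_step M (future_timelike M) (chart_inv c (y + (-e/2) *\<^sub>R T)) (chart_inv c (y + 0 *\<^sub>R T))"
    by (rule curve_step_from_coordinates[where \<beta>' = "\<lambda>_. T"])
      (use e(1) t(1) in \<open>auto intro!: derivative_eq_intros continuous_intros\<close>)
  then show ?thesis using t(2)[of "-e/2"] e(1) y(2) by auto
qed

text \<open>The curve is sheared by a displacement growing linearly from 0 at \<open>s\<close> to
  \<open>w\<close> at \<open>t\<close>. The start stays fixed, the velocity changes by the constant
  \<open>r w\<close>, and the open cone tolerates every small \<open>w\<close>, so the endpoints
  fill a coordinate ball.\<close>

lemma curve_step_endpoint_perturbation:
  assumes \<gamma>: "C1_curve_on M (future_timelike M) {s..t} \<gamma>" and st: "s < t"
    and dom: "\<And>u. u \<in> {s..t} \<Longrightarrow> \<gamma> u \<in> chart_dom c"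
  shows "\<exists>U. open U \<and> \<gamma> t \<in> U \<and> (\<forall>x\<in>U. curve_step M (future_timelike M) (\<gamma> s) x)"
proof -
  obtain \<alpha>' where \<alpha>': "continuous_on {s..t} \<alpha>'"
    "\<And>u. u \<in> {s..t} \<Longrightarrow> ((\<lambda>u. chart_map c (\<gamma> u)) has_vector_derivative \<alpha>' u) (at u within {s..t})"
    "\<And>u. u \<in> {s..t} \<Longrightarrow> future_timelike M c (\<gamma> u) (\<alpha>' u)"
    using C1_curve_in_coordinates[OF \<gamma> dom] by blast
  define \<alpha> where "\<alpha> u = chart_map c (\<gamma> u)" for u
  have \<alpha>: "(\<alpha> has_vector_derivative \<alpha>' u) (at u within {s..t})" if "u \<in> {s..t}" for u
    using \<alpha>'(2)[OF that] unfolding \<alpha>_def .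
  then have cont: "continuous_on {s..t} \<alpha>"
    by (meson continuous_on_eq_continuous_within has_vector_derivative_continuous)
  define r where "r = 1 / (t - s)"
  have r: "r > 0" "(t - s) * r = 1" using st by (auto simp: r_def)
  define f where "f = (\<lambda>(w, u). (\<alpha> u + ((u - s) * r) *\<^sub>R w, \<alpha>' u + r *\<^sub>R w))"
  have "continuous_on (UNIV \<times> {s..t}) f"
    unfolding f_def case_prod_beta
    by (intro continuous_intros continuous_on_compose2[OF cont] continuous_on_compose2[OF \<alpha>'(1)]) auto
  moreover have "f (0, u) \<in> timecone" if "u \<in> {s..t}" for u
    using timecone_iff[OF dom[OF that]] \<alpha>'(3)[OF that] by (simp add: f_def \<alpha>_def)
  ultimately obtain e where e: "e > 0" "\<And>w u. norm w < e \<Longrightarrow> u \<in> {s..t} \<Longrightarrow> f (w, u) \<in> timecone"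
    using continuous_family_stays_in_open[OF _ _ open_timecone, of "{s..t}" f] by auto
  let ?U = "chart_dom c \<inter> chart_map c -` ball (\<alpha> t) e"
  have "curve_step M (future_timelike M) (\<gamma> s) x" if x: "x \<in> ?U" for x
  proof -
    define w where "w = chart_map c x - \<alpha> t"
    have w: "norm w < e" using x by (simp add: w_def dist_norm norm_minus_commute)
    have "curve_step M (future_timelike M) (chart_inv c (\<alpha> s + ((s - s) * r) *\<^sub>R w))
        (chart_inv c (\<alpha> t + ((t - s) * r) *\<^sub>R w))"
    proof (rule curve_step_from_coordinates[OF st, where \<beta>' = "\<lambda>u. \<alpha>' u + r *\<^sub>R w"])
      show "((\<lambda>u. \<alpha> u + ((u - s) * r) *\<^sub>R w) has_vector_derivative \<alpha>' u + r *\<^sub>R w) (at u within {s..t})"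
        if "u \<in> {s..t}" for u
        using \<alpha>[OF that] by (auto intro!: derivative_eq_intros simp: has_real_derivative_iff_has_vector_derivative[symmetric])
      show "continuous_on {s..t} (\<lambda>u. \<alpha>' u + r *\<^sub>R w)" by (intro continuous_intros \<alpha>')
      show "(\<alpha> u + ((u - s) * r) *\<^sub>R w, \<alpha>' u + r *\<^sub>R w) \<in> timecone" if "u \<in> {s..t}" for u
        using e(2)[OF w that] by (simp add: f_def)
    qed
    then show ?thesis using r(2) x dom[of s] st by (simp add: w_def \<alpha>_def)
  qed
  moreover have "open ?U" by (rule open_chart_preimage) simp
  moreover have "\<gamma> t \<in> ?U" using dom[of t] st e(1) by (simp add: \<alpha>_def)
  ultimately show ?thesis by blast
qed

text \<open>The weight \<open>h\<close> solves \<open>- h' = K exp (- K (u - s)) \<ge> K h\<close>: for large \<open>K\<close>, the gain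
  \<open>2 \<epsilon> \<bar>h'\<bar> g(T, \<alpha>')\<close> of pushing the velocity into the cone dominates the error \<open>\<epsilon> h \<partial>\<^sub>T g(\<alpha>', \<alpha>')\<close>
  of moving the base point.\<close>

lemma causal_curve_pushed_to_timelike:
  assumes st: "s < t"
    and \<alpha>: "\<And>u. u \<in> {s..t} \<Longrightarrow> (\<alpha> has_vector_derivative \<alpha>' u) (at u within {s..t})"
    and \<alpha>': "continuous_on {s..t} \<alpha>'"
    and V: "\<And>u. u \<in> {s..t} \<Longrightarrow> \<alpha> u \<in> V"
    and causal: "\<And>u. u \<in> {s..t} \<Longrightarrow> g (\<alpha> u) (\<alpha>' u) (\<alpha>' u) \<le> 0"
    and future: "\<And>u. u \<in> {s..t} \<Longrightarrow> g (\<alpha> u) (X (\<alpha> u)) (\<alpha>' u) < 0"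
    and T: "\<And>u. u \<in> {s..t} \<Longrightarrow> g (\<alpha> u) T (\<alpha>' u) < 0"
  obtains w e where "e > 0"
    "\<And>\<epsilon>. 0 < \<epsilon> \<Longrightarrow> \<epsilon> < e \<Longrightarrow> \<alpha> s + \<epsilon> *\<^sub>R w \<in> V \<and>
       curve_step M (future_timelike M) (chart_inv c (\<alpha> s + \<epsilon> *\<^sub>R w)) (chart_inv c (\<alpha> t))"
proof -
  have cont: "continuous_on {s..t} \<alpha>"
    using \<alpha> by (meson continuous_on_eq_continuous_within has_vector_derivative_continuous)
  define Dg where "Dg y i j = frechet_derivative (\<lambda>y. g y i j) (at y) T" for y i j
  have cont_Dg: "continuous_on V (\<lambda>y. Dg y i j)" for i j
    unfolding Dg_def by (rule smooth_on_continuous_on_derivative[OF smooth_g])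
  \<comment> \<open>The derivative of \<open>g y v v\<close> in the base point along
    \<open>T\<close>, with \<open>v\<close> held fixed.\<close>
  define Q where "Q y v = (\<Sum>i\<in>Basis. \<Sum>j\<in>Basis. (v \<bullet> i) * (v \<bullet> j) * Dg y i j)" for y v
  have cont_Q: "continuous_on D (\<lambda>p. Q (f p) (v p))"
    if "continuous_on D f" "f ` D \<subseteq> V" "continuous_on D v" for D :: "('x::topological_space) set" and f v
    unfolding Q_def by (intro continuous_intros that continuous_on_compose2[OF cont_Dg that(1,2)])
  have V': "\<alpha> ` {s..t} \<subseteq> V" using V by blast
  have "continuous_on {s..t} (\<lambda>u. g (\<alpha> u) T (\<alpha>' u))"
    by (intro continuous_on_g cont V' \<alpha>' continuous_intros)
  from continuous_attains_sup[OF _ _ this] obtain u0 where "u0 \<in> {s..t}"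
    "\<And>u. u \<in> {s..t} \<Longrightarrow> g (\<alpha> u) T (\<alpha>' u) \<le> g (\<alpha> u0) T (\<alpha>' u0)"
    using st by auto
  then obtain k where k: "k > 0" "\<And>u. u \<in> {s..t} \<Longrightarrow> g (\<alpha> u) T (\<alpha>' u) \<le> - k"
    using T[of u0] by (metis neg_0_less_iff_less minus_minus)
  have "compact ((\<lambda>u. Q (\<alpha> u) (\<alpha>' u)) ` {s..t})"
    by (intro compact_continuous_image cont_Q cont V' \<alpha>') auto
  then obtain L where L: "\<And>u. u \<in> {s..t} \<Longrightarrow> \<bar>Q (\<alpha> u) (\<alpha>' u)\<bar> \<le> L"
    using compact_imp_bounded bounded_iff by (metis (no_types, lifting) imageI real_norm_def)
  then have L0: "L \<ge> 0" using st by (meson abs_ge_zero atLeastAtMost_iff less_imp_le order_refl order_trans)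
  \<comment> \<open>\<open>L\<close> bounds the error rate and \<open>k\<close> the gain rate. Since
    \<open>K k = L + 1\<close>, the gain \<open>2 K E k\<close> exceeds \<open>E L\<close>, hence
    also \<open>h L\<close>.\<close>
  define K where "K = (L + 1) / k"
  have K: "K > 0" "K * k = L + 1" using k(1) L0 by (auto simp: K_def)
  define E where "E u = exp (- K * (u - s))" for u
  \<comment> \<open>Subtracting \<open>E t\<close> makes \<open>h\<close> vanish at
    \<open>t\<close>, so the end of the curve stays put; the start moves by
    \<open>- \<epsilon> h s T\<close>.\<close>
  define h where "h u = E u - E t" for u
  have h: "0 \<le> h u" "h u \<le> E u" "0 < E u" if "u \<in> {s..t}" for u
    using that K(1) by (auto simp: h_def E_def)
  \<comment> \<open>Position and velocity of the pushed curve, with \<open>h\<close> and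
    \<open>- h'\<close> carried along because the inequality to be preserved involves them.\<close>
  define f where "f = (\<lambda>(\<epsilon>::real, u). (\<alpha> u - (\<epsilon> * h u) *\<^sub>R T, \<alpha>' u + (\<epsilon> * (K * E u)) *\<^sub>R T, h u, K * E u))"
  have cont_f: "continuous_on (UNIV \<times> {s..t}) f"
    unfolding f_def case_prod_beta h_def E_def
    by (intro continuous_intros continuous_on_compose2[OF cont] continuous_on_compose2[OF \<alpha>']) auto
  define Y where "Y = V \<times> (UNIV :: ('e \<times> real \<times> real) set)"
  \<comment> \<open>Evaluated on \<open>f\<close>, this is the derivative in \<epsilon> of the
    square of the velocity; \<open>\<Psi>\<close> tests the time orientation.\<close>
  define \<Phi> where "\<Phi> = (\<lambda>(y, v, h, q). - h * Q y v + 2 * q * g y T v)"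
  define \<Psi> where "\<Psi> = (\<lambda>(y, v, h::real, q::real). g y (X y) v)"
  have fst_Y: "fst ` Y \<subseteq> V" by (auto simp: Y_def)
  have "open Y" unfolding Y_def by (intro open_Times open_V) auto
  moreover have "continuous_on Y \<Phi>"
    unfolding \<Phi>_def case_prod_beta by (intro continuous_intros cont_Q continuous_on_g fst_Y)
  moreover have "continuous_on Y \<Psi>"
    unfolding \<Psi>_def case_prod_beta
    by (intro continuous_intros continuous_on_g fst_Y continuous_on_compose2[OF continuous_on_X])
  ultimately have "open ((Y \<inter> \<Phi> -` {..<0}) \<inter> (Y \<inter> \<Psi> -` {..<0}))"
    by (intro open_Int continuous_open_preimage) auto
  moreover have "f (0, u) \<in> (Y \<inter> \<Phi> -` {..<0}) \<inter> (Y \<inter> \<Psi> -` {..<0})" if u: "u \<in> {s..t}" for u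
  proof -
    have "- h u * Q (\<alpha> u) (\<alpha>' u) \<le> h u * L"
      using L[OF u] h(1)[OF u] by (metis abs_le_D2 mult_left_mono mult_minus_left mult_minus_right)
    also have "\<dots> \<le> E u * L" using h[OF u] L0 by (intro mult_right_mono) auto
    also have "\<dots> < 2 * (K * E u) * k"
    proof -
      have "2 * (K * E u) * k = E u * (2 * (L + 1))" using K(2) by (simp add: mult_ac)
      then show ?thesis using h(3)[OF u] L0 by simp
    qed
    also have "\<dots> \<le> 2 * (K * E u) * (- g (\<alpha> u) T (\<alpha>' u))"
      by (rule mult_left_mono) (use k(2)[OF u] h(3)[OF u] K(1) in auto)
    finally have "\<Phi> (f (0, u)) < 0" by (simp add: \<Phi>_def f_def)
    moreover have "\<Psi> (f (0, u)) < 0" using future[OF u] by (simp add: \<Psi>_def f_def)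
    ultimately show ?thesis using V[OF u] by (simp add: Y_def f_def)
  qed
  ultimately obtain e where e: "e > 0"
    "\<And>\<epsilon> u. norm \<epsilon> < e \<Longrightarrow> u \<in> {s..t} \<Longrightarrow> f (\<epsilon>, u) \<in> (Y \<inter> \<Phi> -` {..<0}) \<inter> (Y \<inter> \<Psi> -` {..<0})"
    using continuous_family_stays_in_open[OF _ cont_f] by (metis compact_Icc)
  define \<beta> where "\<beta> \<epsilon> u = \<alpha> u - (\<epsilon> * h u) *\<^sub>R T" for \<epsilon> u
  define \<beta>' where "\<beta>' \<epsilon> u = \<alpha>' u + (\<epsilon> * (K * E u)) *\<^sub>R T" for \<epsilon> u
  have near: "\<beta> \<epsilon> u \<in> V" "- h u * Q (\<beta> \<epsilon> u) (\<beta>' \<epsilon> u) + 2 * (K * E u) * g (\<beta> \<epsilon> u) T (\<beta>' \<epsilon> u) < 0"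
      "g (\<beta> \<epsilon> u) (X (\<beta> \<epsilon> u)) (\<beta>' \<epsilon> u) < 0" if "\<bar>\<epsilon>\<bar> < e" "u \<in> {s..t}" for \<epsilon> u
    using e(2)[of \<epsilon> u] that by (auto simp: \<beta>_def \<beta>'_def f_def Y_def \<Phi>_def \<Psi>_def)
  \<comment> \<open>Openness alone cannot give this, since at \<epsilon> = 0 the square may be zero.
    Its derivative in \<epsilon> is negative all the way from 0, and that makes it strictly
    negative.\<close>
  have timelike: "g (\<beta> \<epsilon> u) (\<beta>' \<epsilon> u) (\<beta>' \<epsilon> u) < 0" if \<epsilon>: "0 < \<epsilon>" "\<epsilon> < e" and u: "u \<in> {s..t}" for \<epsilon> u
  proof -
    \<comment> \<open>A sum over basis components, to which the product rule applies term by term;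
      it agrees with \<open>g\<close> as long as the pushed point stays in \<open>V\<close>.\<close>
    define F where "F \<epsilon> = (\<Sum>i\<in>Basis. \<Sum>j\<in>Basis. (\<beta>' \<epsilon> u \<bullet> i) * (\<beta>' \<epsilon> u \<bullet> j) * g (\<beta> \<epsilon> u) i j)" for \<epsilon>
    have F: "F \<epsilon> = g (\<beta> \<epsilon> u) (\<beta>' \<epsilon> u) (\<beta>' \<epsilon> u)" if "\<bar>\<epsilon>\<bar> < e" for \<epsilon>
      unfolding F_def by (rule bilinear_expansion[symmetric, OF bilinear_g[OF near(1)[OF that u]]])
    have "F \<epsilon> < F 0"
    proof (rule DERIV_neg_imp_decreasing[OF \<epsilon>(1)])
      fix \<delta> assume "0 \<le> \<delta>" "\<delta> \<le> \<epsilon>"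
      then have \<delta>: "\<bar>\<delta>\<bar> < e" using \<epsilon> by auto
      note b = bilinear_g[OF near(1)[OF \<delta> u]]
      have dg: "((\<lambda>\<epsilon>. g (\<beta> \<epsilon> u) i j) has_real_derivative - h u * Dg (\<beta> \<delta> u) i j) (at \<delta>)" for i j
      proof -
        have 1: "((\<lambda>\<epsilon>. \<beta> \<epsilon> u) has_vector_derivative (- h u) *\<^sub>R T) (at \<delta>)"
          unfolding \<beta>_def
          by (auto intro!: derivative_eq_intros simp: has_real_derivative_iff_has_vector_derivative[symmetric])
        have 2: "((\<lambda>y. g y i j) has_derivative frechet_derivative (\<lambda>y. g y i j) (at (\<beta> \<delta> u))) (at (\<beta> \<delta> u))"
          by (rule smooth_on_has_derivative[OF smooth_g near(1)[OF \<delta> u]])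
        from vector_derivative_diff_chain_within[OF 1 has_derivative_at_withinI[OF 2]]
        have "((\<lambda>\<epsilon>. g (\<beta> \<epsilon> u) i j) has_vector_derivative
            frechet_derivative (\<lambda>y. g y i j) (at (\<beta> \<delta> u)) ((- h u) *\<^sub>R T)) (at \<delta>)"
          by (simp add: comp_def)
        then show ?thesis
          by (simp only: linear_cmul[OF has_derivative_linear[OF 2]] Dg_def
              has_real_derivative_iff_has_vector_derivative real_scaleR_def)
      qed
      have dv: "((\<lambda>\<epsilon>. \<beta>' \<epsilon> u \<bullet> i) has_real_derivative K * E u * (T \<bullet> i)) (at \<delta>)" for i
        unfolding \<beta>'_def by (auto intro!: derivative_eq_intros simp: inner_add_left)
      have "(F has_real_derivative
          (\<Sum>i\<in>Basis. \<Sum>j\<in>Basis. (K * E u) * ((T \<bullet> i) * (\<beta>' \<delta> u \<bullet> j) * g (\<beta> \<delta> u) i j)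
             + (K * E u) * ((\<beta>' \<delta> u \<bullet> i) * (T \<bullet> j) * g (\<beta> \<delta> u) i j)
             + (- h u) * ((\<beta>' \<delta> u \<bullet> i) * (\<beta>' \<delta> u \<bullet> j) * Dg (\<beta> \<delta> u) i j))) (at \<delta>)"
        unfolding F_def
        by (rule derivative_eq_intros dv dg refl | simp add: algebra_simps)+
      also have "(\<Sum>i\<in>Basis. \<Sum>j\<in>Basis. (K * E u) * ((T \<bullet> i) * (\<beta>' \<delta> u \<bullet> j) * g (\<beta> \<delta> u) i j)
             + (K * E u) * ((\<beta>' \<delta> u \<bullet> i) * (T \<bullet> j) * g (\<beta> \<delta> u) i j)
             + (- h u) * ((\<beta>' \<delta> u \<bullet> i) * (\<beta>' \<delta> u \<bullet> j) * Dg (\<beta> \<delta> u) i j))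
          = (K * E u) * g (\<beta> \<delta> u) T (\<beta>' \<delta> u) + (K * E u) * g (\<beta> \<delta> u) (\<beta>' \<delta> u) T
             + (- h u) * Q (\<beta> \<delta> u) (\<beta>' \<delta> u)"
        unfolding sum.distrib Q_def sum_distrib_left[symmetric]
          bilinear_expansion[OF b, of T] bilinear_expansion[OF b, of _ T] ..
      also have "\<dots> = - h u * Q (\<beta> \<delta> u) (\<beta>' \<delta> u) + 2 * (K * E u) * g (\<beta> \<delta> u) T (\<beta>' \<delta> u)"
        using symmetric_g[OF near(1)[OF \<delta> u], of "\<beta>' \<delta> u" T] by simp
      finally show "\<exists>y. (F has_real_derivative y) (at \<delta>) \<and> y < 0"
        using near(2)[OF \<delta> u] by blast
    qed
    moreover have "F 0 = g (\<alpha> u) (\<alpha>' u) (\<alpha>' u)" using F[of 0] e(1) by (simp add: \<beta>_def \<beta>'_def)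
    ultimately show ?thesis using causal[OF u] F[of \<epsilon>] \<epsilon> by simp
  qed
  have step: "curve_step M (future_timelike M) (chart_inv c (\<beta> \<epsilon> s)) (chart_inv c (\<beta> \<epsilon> t))"
    if \<epsilon>: "0 < \<epsilon>" "\<epsilon> < e" for \<epsilon>
  proof (rule curve_step_from_coordinates[OF st, where \<beta>' = "\<beta>' \<epsilon>"])
    show "(\<beta> \<epsilon> has_vector_derivative \<beta>' \<epsilon> u) (at u within {s..t})" if u: "u \<in> {s..t}" for u
    proof -
      have "((\<lambda>u. \<epsilon> * h u) has_real_derivative - (\<epsilon> * (K * E u))) (at u within {s..t})"
        unfolding h_def E_def by (auto intro!: derivative_eq_intros)
      then have "((\<lambda>u. \<alpha> u - (\<epsilon> * h u) *\<^sub>R T) has_vector_derivative \<alpha>' u - (- (\<epsilon> * (K * E u))) *\<^sub>R T)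
          (at u within {s..t})"
        using has_vector_derivative_diff[OF \<alpha>[OF u] has_vector_derivative_scaleR[OF _ has_vector_derivative_const[of T]]]
        by fastforce
      moreover have "\<beta> \<epsilon> = (\<lambda>u. \<alpha> u - (\<epsilon> * h u) *\<^sub>R T)" by (simp add: \<beta>_def fun_eq_iff)
      ultimately show ?thesis by (simp add: \<beta>'_def)
    qed
    show "continuous_on {s..t} (\<beta>' \<epsilon>)"
      unfolding \<beta>'_def E_def by (intro continuous_intros \<alpha>')
    show "(\<beta> \<epsilon> u, \<beta>' \<epsilon> u) \<in> timecone" if "u \<in> {s..t}" for u
      using near[of \<epsilon> u] timelike[OF \<epsilon> that] \<epsilon> that unfolding timecone_def by auto
  qed
  have ends: "\<beta> \<epsilon> s = \<alpha> s + \<epsilon> *\<^sub>R ((- h s) *\<^sub>R T)" "\<beta> \<epsilon> t = \<alpha> t" for \<epsilon>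
    by (simp_all add: \<beta>_def h_def algebra_simps flip: scaleR_minus_left)
  show ?thesis
  proof (rule that[OF e(1)])
    fix \<epsilon> assume \<epsilon>: "0 < \<epsilon>" "\<epsilon> < e"
    show "\<alpha> s + \<epsilon> *\<^sub>R ((- h s) *\<^sub>R T) \<in> V \<and> curve_step M (future_timelike M)
        (chart_inv c (\<alpha> s + \<epsilon> *\<^sub>R ((- h s) *\<^sub>R T))) (chart_inv c (\<alpha> t))"
      using step[OF \<epsilon>] near(1)[of \<epsilon> s] \<epsilon> st unfolding ends by simp
  qed
qed

end

section \<open>Causality of spacetimes\<close>

lemma exists_spacetime_chart:
  assumes "spacetime M"
  obtains c where "spacetime_chart M c" "x \<in> chart_dom c"
proof -
  have "x \<in> (\<Union>c\<in>atlas M. chart_dom c)"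
    using assms unfolding spacetime_def smooth_atlas_def by blast
  then show ?thesis using that assms by (auto simp: spacetime_chart_def)
qed

text \<open>Only the tail of the last piece is altered: it fits into a chart around
  \<open>y\<close>, where the endpoint can be moved while the start of the tail stays fixed.\<close>

lemma open_timelike_future:
  assumes M: "spacetime M"
  shows "open {y. x \<lless>\<^bsub>M\<^esub> y}"
proof (subst open_subopen, intro ballI)
  fix y assume "y \<in> {y. x \<lless>\<^bsub>M\<^esub> y}"
  then have "(curve_step M (future_timelike M))\<^sup>+\<^sup>+ x y" by (simp add: timelike_rel_iff_tranclp)
  then obtain q where q: "(curve_step M (future_timelike M))\<^sup>*\<^sup>* x q" "curve_step M (future_timelike M) q y"
    by (cases rule: tranclp.cases) (blast intro: tranclp_into_rtranclp)+
  obtain a b \<gamma> where \<gamma>: "a < b" "C1_curve_on M (future_timelike M) {a..b} \<gamma>" "\<gamma> a = q" "\<gamma> b = y"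
    using q(2) unfolding curve_step_def by blast
  obtain c where c: "spacetime_chart M c" "y \<in> chart_dom c" by (rule exists_spacetime_chart[OF M])
  interpret spacetime_chart M c by fact
  have "continuous_on {a..b} \<gamma>" using \<gamma>(2) unfolding C1_curve_on_def by blast
  then obtain \<delta> where \<delta>: "\<delta> > 0" "\<And>s. s \<in> {a..b} \<Longrightarrow> \<bar>s - b\<bar> < \<delta> \<Longrightarrow> \<gamma> s \<in> chart_dom c"
    using continuous_on_neighbourhood[of "{a..b}" \<gamma> b "chart_dom c"] open_dom c(2) \<gamma>(1,4) by auto
  \<comment> \<open>Half of \<delta> keeps the closed tail strictly inside the neighbourhood; the
    maximum keeps it inside the piece.\<close>
  define s where "s = max a (b - \<delta> / 2)"
  have s: "a \<le> s" "s < b" "b - s < \<delta>" using \<gamma>(1) \<delta>(1) by (auto simp: s_def)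
  have tail: "C1_curve_on M (future_timelike M) {s..b} \<gamma>"
    by (rule C1_curve_on_mono[OF \<gamma>(2)]) (use s in auto)
  have tail_dom: "\<gamma> u \<in> chart_dom c" if "u \<in> {s..b}" for u using \<delta>(2)[of u] s that by auto
  obtain U where U: "open U" "\<gamma> b \<in> U"
      "\<And>z. z \<in> U \<Longrightarrow> curve_step M (future_timelike M) (\<gamma> s) z"
    using curve_step_endpoint_perturbation[OF tail s(2) tail_dom] by blast
  have "(curve_step M (future_timelike M))\<^sup>*\<^sup>* q (\<gamma> s)"
    using curve_step_subinterval[OF \<gamma>(2), of a s] s \<gamma>(3) by (cases "a = s") auto
  then have "x \<lless>\<^bsub>M\<^esub> z" if "z \<in> U" for z
    using q(1) U(3)[OF that] unfolding timelike_rel_iff_tranclp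
    by (meson rtranclp_into_tranclp1 rtranclp_trans)
  then show "\<exists>T. open T \<and> y \<in> T \<and> T \<subseteq> {y. x \<lless>\<^bsub>M\<^esub> y}" using U \<gamma>(4) by blast
qed

lemma in_closure_timelike_past:
  assumes M: "spacetime M"
  shows "x \<in> closure {p. p \<lless>\<^bsub>M\<^esub> x}"
  unfolding closure_iff_nhds_not_empty
proof (intro allI impI)
  fix A W assume W: "W \<subseteq> A" "open W" "x \<in> W"
  obtain c where c: "spacetime_chart M c" "x \<in> chart_dom c" by (rule exists_spacetime_chart[OF M])
  from spacetime_chart.timelike_past_accumulates[OF c W(2,3)]
  obtain p where "p \<in> W" "curve_step M (future_timelike M) p x" by blast
  then show "{p. p \<lless>\<^bsub>M\<^esub> x} \<inter> A \<noteq> {}"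
    using W(1) by (auto simp: timelike_rel_iff_tranclp)
qed

text \<open>In a chart, a short causal segment can be pushed into a timelike one with the same end
  and a slightly shifted start, and the open future of \<open>x\<close> still contains that start.
  The implication from \<open>\<gamma> s\<close> to \<open>\<gamma> t\<close> composes over adjacent
  intervals, so \<open>Bolzano\<close> passes from short segments to the whole curve.\<close>

lemma timelike_rel_along_causal_curve:
  assumes M: "spacetime M" and \<gamma>: "C1_curve_on M (future_causal M) {a..b} \<gamma>"
    and ab: "a < b" and x: "x \<lless>\<^bsub>M\<^esub> \<gamma> a"
  shows "x \<lless>\<^bsub>M\<^esub> \<gamma> b"
proof -
  have "a \<le> a \<and> b \<le> b \<and> x \<lless>\<^bsub>M\<^esub> \<gamma> a \<longrightarrow> x \<lless>\<^bsub>M\<^esub> \<gamma> b"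
    using less_imp_le[OF ab]
  \<comment> \<open>The bounds on \<open>s\<close> and \<open>t\<close> belong to the property
    because its local form is tested on all short intervals around \<open>u\<close>, including those
    that stick out of the domain.\<close>
  proof (rule Bolzano[where P = "\<lambda>s t. a \<le> s \<and> t \<le> b \<and> x \<lless>\<^bsub>M\<^esub> \<gamma> s \<longrightarrow> x \<lless>\<^bsub>M\<^esub> \<gamma> t"])
    fix u assume u: "a \<le> u" "u \<le> b"
    obtain c where c: "spacetime_chart M c" "\<gamma> u \<in> chart_dom c" by (rule exists_spacetime_chart[OF M])
    interpret spacetime_chart M c by fact
    define S where "S = {t\<in>{a..b}. \<gamma> t \<in> chart_dom c}"
    have cont_\<gamma>: "continuous_on {a..b} \<gamma>" using \<gamma> unfolding C1_curve_on_def by blast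
    obtain \<delta>1 where \<delta>1: "\<delta>1 > 0" "\<And>s. s \<in> {a..b} \<Longrightarrow> \<bar>s - u\<bar> < \<delta>1 \<Longrightarrow> \<gamma> s \<in> chart_dom c"
      using continuous_on_neighbourhood[OF cont_\<gamma> _ open_dom c(2)] u by auto
    obtain \<alpha>' where \<alpha>': "continuous_on S \<alpha>'"
      "\<And>t. t \<in> S \<Longrightarrow> ((chart_map c \<circ> \<gamma>) has_vector_derivative \<alpha>' t) (at t within {a..b})"
      "\<And>t. t \<in> S \<Longrightarrow> future_causal M c (\<gamma> t) (\<alpha>' t)"
      using chart \<gamma> unfolding C1_curve_on_def S_def by (metis (no_types, lifting) mem_Collect_eq)
    define \<alpha> where "\<alpha> t = chart_map c (\<gamma> t)" for t
    have \<alpha>_eq: "\<alpha> = chart_map c \<circ> \<gamma>" by (simp add: \<alpha>_def fun_eq_iff)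
    have \<alpha>V: "\<alpha> t \<in> V" if "t \<in> S" for t using that by (simp add: \<alpha>_def S_def)
    have causal: "g (\<alpha> t) (\<alpha>' t) (\<alpha>' t) \<le> 0" "g (\<alpha> t) (X (\<alpha> t)) (\<alpha>' t) < 0" if "t \<in> S" for t
      using \<alpha>'(3)[OF that] that by (simp_all add: future_causal_def \<alpha>_def S_def g_def X_def)
    have uS: "u \<in> S" using u c(2) by (simp add: S_def)
    \<comment> \<open>The pushing lemma takes a constant direction. The time field frozen at
      \<open>u\<close> still pairs negatively with the velocity nearby.\<close>
    define T where "T = X (\<alpha> u)"
    have "continuous_on S \<alpha>"
      unfolding \<alpha>_def
      by (rule continuous_on_compose2[OF continuous_on_chart continuous_on_subset[OF cont_\<gamma>]])
        (auto simp: S_def)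
    then have "continuous_on S (\<lambda>t. g (\<alpha> t) T (\<alpha>' t))"
      using \<alpha>V by (intro continuous_on_g \<alpha>' continuous_intros) auto
    then obtain \<delta>2 where \<delta>2: "\<delta>2 > 0" "\<And>t. t \<in> S \<Longrightarrow> \<bar>t - u\<bar> < \<delta>2 \<Longrightarrow> g (\<alpha> t) T (\<alpha>' t) < 0"
      using continuous_on_neighbourhood[of S "\<lambda>t. g (\<alpha> t) T (\<alpha>' t)" u "{..<0}"] uS causal(2)[OF uS]
      unfolding T_def by auto
    have "x \<lless>\<^bsub>M\<^esub> \<gamma> t"
      if st: "s \<le> u" "u \<le> t" "t - s < min \<delta>1 \<delta>2" "a \<le> s" "t \<le> b" and x: "x \<lless>\<^bsub>M\<^esub> \<gamma> s" for s t
    proof (cases "s = t")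
      case False
      then have "s < t" using st by simp
      have sub: "{s..t} \<subseteq> S" using \<delta>1(2) st by (auto simp: S_def)
      have sub': "{s..t} \<subseteq> {a..b}" using st by auto
      obtain w e where e: "e > 0" "\<And>\<epsilon>. 0 < \<epsilon> \<Longrightarrow> \<epsilon> < e \<Longrightarrow> \<alpha> s + \<epsilon> *\<^sub>R w \<in> V \<and>
          curve_step M (future_timelike M) (chart_inv c (\<alpha> s + \<epsilon> *\<^sub>R w)) (chart_inv c (\<alpha> t))"
      proof (rule causal_curve_pushed_to_timelike[OF \<open>s < t\<close>, of \<alpha> \<alpha>' T])
        show "(\<alpha> has_vector_derivative \<alpha>' v) (at v within {s..t})" if "v \<in> {s..t}" for v
          unfolding \<alpha>_eq
          by (rule has_vector_derivative_within_subset[OF \<alpha>'(2) sub']) (use that sub in blast)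
        show "continuous_on {s..t} \<alpha>'" by (rule continuous_on_subset[OF \<alpha>'(1) sub])
        show "g (\<alpha> v) T (\<alpha>' v) < 0" if "v \<in> {s..t}" for v
          using \<delta>2(2)[of v] that sub st by auto
      qed (use sub causal \<alpha>V in \<open>auto\<close>)
      have s_dom: "\<gamma> s \<in> chart_dom c" and t_dom: "\<gamma> t \<in> chart_dom c"
        using subsetD[OF sub, of s] subsetD[OF sub, of t] \<open>s < t\<close> by (auto simp: S_def)
      define A where "A = (\<lambda>\<epsilon>::real. \<alpha> s + \<epsilon> *\<^sub>R w) -` (V \<inter> chart_inv c -` {y. x \<lless>\<^bsub>M\<^esub> y})"
      have "open A" unfolding A_def
        by (intro open_vimage open_chart_inv_preimage open_timelike_future M continuous_intros)
      moreover have "0 \<in> A" using s_dom x by (simp add: A_def \<alpha>_def)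
      ultimately obtain r where r: "r > 0" "ball 0 r \<subseteq> A" using open_contains_ball by blast
      define \<epsilon> where "\<epsilon> = min e r / 2"
      have \<epsilon>: "0 < \<epsilon>" "\<epsilon> < e" "\<epsilon> < r" using e(1) r(1) by (auto simp: \<epsilon>_def)
      then have "\<epsilon> \<in> A" by (intro subsetD[OF r(2)]) (auto simp: dist_real_def)
      then have "x \<lless>\<^bsub>M\<^esub> chart_inv c (\<alpha> s + \<epsilon> *\<^sub>R w)" by (simp add: A_def)
      moreover have "chart_inv c (\<alpha> s + \<epsilon> *\<^sub>R w) \<lless>\<^bsub>M\<^esub> \<gamma> t"
        using e(2)[OF \<epsilon>(1,2)] t_dom by (auto simp: timelike_rel_iff_tranclp \<alpha>_def)
      ultimately show ?thesis by (rule timelike_rel_trans)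
    qed (use x in simp)
    then show "\<exists>d>0. \<forall>s t. s \<le> u \<and> u \<le> t \<and> t - s < d \<longrightarrow>
        a \<le> s \<and> t \<le> b \<and> x \<lless>\<^bsub>M\<^esub> \<gamma> s \<longrightarrow> x \<lless>\<^bsub>M\<^esub> \<gamma> t"
      using \<delta>1(1) \<delta>2(1) by (intro exI[of _ "min \<delta>1 \<delta>2"]) auto
  qed auto
  then show ?thesis using x by simp
qed

lemma timelike_causal_rel_trans:
  assumes M: "spacetime M" and "x \<lless>\<^bsub>M\<^esub> y" "y \<preceq>\<^bsub>M\<^esub> z"
  shows "x \<lless>\<^bsub>M\<^esub> z"
  using assms(3) unfolding causal_rel_iff_rtranclp
proof (induction rule: rtranclp_induct)
  case (step u v)
  then show ?case
    using timelike_rel_along_causal_curve[OF M] unfolding curve_step_def by blast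
qed (rule assms(2))

lemma compact_neighbourhood:
  fixes M :: "('a::{t2_space, second_countable_topology}, 'e::euclidean_space) lorentz_structure"
    and x :: 'a
  assumes M: "spacetime M"
  shows "\<exists>U. compact U \<and> x \<in> interior U"
proof -
  obtain c where c: "spacetime_chart M c" "x \<in> chart_dom c" by (rule exists_spacetime_chart[OF M])
  interpret spacetime_chart M c by fact
  obtain e where e: "e > 0" "cball (chart_map c x) e \<subseteq> V"
    using open_V c(2) open_contains_cball by (metis chart_in_V)
  let ?U = "chart_inv c ` cball (chart_map c x) e"
  have "compact ?U"
    by (intro compact_continuous_image continuous_on_subset[OF continuous_on_chart_inv] e) simp
  moreover have "chart_dom c \<inter> chart_map c -` ball (chart_map c x) e \<subseteq> ?U"
  proof
    fix y assume "y \<in> chart_dom c \<inter> chart_map c -` ball (chart_map c x) e"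
    then show "y \<in> ?U" by (intro image_eqI[of _ _ "chart_map c y"]) auto
  qed
  then have "chart_dom c \<inter> chart_map c -` ball (chart_map c x) e \<subseteq> interior ?U"
    by (intro interior_maximal open_chart_preimage) auto
  then have "x \<in> interior ?U" using c(2) e(1) by auto
  ultimately show ?thesis by blast
qed

lemma closed_causal_space_spacetime:
  assumes M: "spacetime M" and "closed {(x, y). x \<preceq>\<^bsub>M\<^esub> y}"
  shows "closed_causal_space (\<lambda>x y. x \<preceq>\<^bsub>M\<^esub> y) (\<lambda>x y. x \<lless>\<^bsub>M\<^esub> y)"
proof
  show "x \<preceq>\<^bsub>M\<^esub> x" for x by (simp add: causal_rel_def)
  show "x \<preceq>\<^bsub>M\<^esub> y" if "x \<lless>\<^bsub>M\<^esub> y" for x y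
    using M that timelike_imp_causal_rel unfolding spacetime_def by blast
qed (fact assms(2) causal_rel_trans timelike_causal_rel_trans[OF M] open_timelike_future[OF M]
      in_closure_timelike_past[OF M] causal_rel_frontier_crossing compact_neighbourhood[OF M])+

section \<open>Causality as antisymmetry of the causal relation\<close>

lemma causal_curve_non_constant:
  assumes M: "spacetime M" and \<gamma>: "C1_curve_on M (future_causal M) {a..b} \<gamma>" and ab: "a < b"
  shows "\<exists>t\<in>{a..b}. \<gamma> t \<noteq> \<gamma> a"
proof (rule ccontr)
  assume "\<not> ?thesis"
  then have const: "\<And>t. t \<in> {a..b} \<Longrightarrow> \<gamma> t = \<gamma> a" by blast
  obtain c where c: "spacetime_chart M c" "\<gamma> a \<in> chart_dom c" by (rule exists_spacetime_chart[OF M])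
  obtain v where v: "((chart_map c \<circ> \<gamma>) has_vector_derivative v) (at a within {a..b})"
      "future_causal M c (\<gamma> a) v"
    using \<gamma> spacetime_chart.chart[OF c(1)] c(2) ab unfolding C1_curve_on_def
    by (metis atLeastAtMost_iff less_imp_le order_refl)
  have "((\<lambda>_. chart_map c (\<gamma> a)) has_vector_derivative v) (at a within {a..b})"
  proof (rule has_vector_derivative_transform[OF _ _ v(1)])
    show "chart_map c (\<gamma> a) = (chart_map c \<circ> \<gamma>) t" if "t \<in> {a..b}" for t
      unfolding comp_def const[OF that] ..
  qed (use ab in simp)
  \<comment> \<open>One-sided derivatives at the left end of a nondegenerate interval are
    unique.\<close>
  then have "v = 0"
    using vector_derivative_unique_within[OF _ _ has_vector_derivative_const, of a "{a..b}"] ab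
    by (metis at_within_Icc_at_right trivial_limit_at_right_real)
  then show False using v(2) by (simp add: future_causal_def)
qed

text \<open>The first piece of a closed causal curve is not constant, so it reaches a point other
  than the base point; that point lies both after and before the base point.\<close>

lemma causal_if_antisym:
  assumes M: "spacetime M" and antisym: "\<And>x y. x \<preceq>\<^bsub>M\<^esub> y \<Longrightarrow> y \<preceq>\<^bsub>M\<^esub> x \<Longrightarrow> x = y"
  shows "causal M"
  unfolding causal_iff_acyclic
proof (intro allI notI)
  fix x assume "(curve_step M (future_causal M))\<^sup>+\<^sup>+ x x"
  then obtain y where y: "curve_step M (future_causal M) x y" "(curve_step M (future_causal M))\<^sup>*\<^sup>* y x"
    by (meson tranclpD)
  then obtain a b \<gamma> where \<gamma>: "a < b" "C1_curve_on M (future_causal M) {a..b} \<gamma>" "\<gamma> a = x" "\<gamma> b = y"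
    unfolding curve_step_def by blast
  obtain t where t: "t \<in> {a..b}" "\<gamma> t \<noteq> x" using causal_curve_non_constant[OF M \<gamma>(2,1)] \<gamma>(3) by auto
  have "x \<preceq>\<^bsub>M\<^esub> \<gamma> t"
    using curve_step_subinterval[OF \<gamma>(2), of a t] t \<gamma>(3)
    by (cases "a = t") (auto simp: causal_rel_iff_rtranclp)
  moreover have "\<gamma> t \<preceq>\<^bsub>M\<^esub> y"
    using curve_step_subinterval[OF \<gamma>(2), of t b] t \<gamma>(4)
    by (cases "t = b") (auto simp: causal_rel_iff_rtranclp)
  then have "\<gamma> t \<preceq>\<^bsub>M\<^esub> x"
    using y(2) causal_rel_trans unfolding causal_rel_iff_rtranclp by (meson rtranclp_trans)
  ultimately show False using antisym t(2) by blast
qed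

lemma antisym_if_causal:
  assumes "causal M" "x \<preceq>\<^bsub>M\<^esub> y" "y \<preceq>\<^bsub>M\<^esub> x"
  shows "x = y"
proof (rule ccontr)
  assume "x \<noteq> y"
  then have "(curve_step M (future_causal M))\<^sup>+\<^sup>+ x y" "(curve_step M (future_causal M))\<^sup>+\<^sup>+ y x"
    using assms(2,3) unfolding causal_rel_iff_rtranclp by (auto dest: rtranclpD)
  then show False using assms(1) unfolding causal_iff_acyclic by (meson tranclp_trans)
qed

section \<open>Global hyperbolicity and forward completeness\<close>

lemma globally_hyperbolic_if_chronologically_forward_complete:
  assumes M: "spacetime M" and closed: "closed {(x, y). x \<preceq>\<^bsub>M\<^esub> y}"
    and complete: "chronologically_forward_complete M"
  shows "globally_hyperbolic M"
proof -
  interpret closed_causal_space "\<lambda>x y. x \<preceq>\<^bsub>M\<^esub> y" "\<lambda>x y. x \<lless>\<^bsub>M\<^esub> y"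
    by (rule closed_causal_space_spacetime[OF M closed])
  interpret chronologically_complete_space "\<lambda>x y. x \<preceq>\<^bsub>M\<^esub> y" "\<lambda>x y. x \<lless>\<^bsub>M\<^esub> y"
    by standard (use complete in \<open>auto simp: chronologically_forward_complete_def\<close>)
  show ?thesis
    unfolding globally_hyperbolic_def causal_diamond_def
    using causal_if_antisym[OF M antisym] compact_diamond by blast
qed

lemma causally_forward_complete_if_globally_hyperbolic:
  fixes M :: "('a::{t2_space, second_countable_topology}, 'e::euclidean_space) lorentz_structure"
  assumes M: "spacetime M" and closed: "closed {(x, y). x \<preceq>\<^bsub>M\<^esub> y}" and gh: "globally_hyperbolic M"
  shows "causally_forward_complete M"
  unfolding causally_forward_complete_def
proof (intro allI impI)
  interpret closed_causal_space "\<lambda>x y. x \<preceq>\<^bsub>M\<^esub> y" "\<lambda>x y. x \<lless>\<^bsub>M\<^esub> y"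
    by (rule closed_causal_space_spacetime[OF M closed])
  fix x :: "nat \<Rightarrow> 'a" and z
  assume x: "\<forall>n. x n \<preceq>\<^bsub>M\<^esub> x (Suc n) \<and> x (Suc n) \<preceq>\<^bsub>M\<^esub> z"
  show "convergent x"
  proof (rule convergent_in_compact_diamond)
    show "compact {y. x 0 \<preceq>\<^bsub>M\<^esub> y \<and> y \<preceq>\<^bsub>M\<^esub> z}"
      using gh unfolding globally_hyperbolic_def causal_diamond_def by blast
    show "x n \<preceq>\<^bsub>M\<^esub> x (Suc n)" "x n \<preceq>\<^bsub>M\<^esub> z" for n using x causal_rel_trans by blast+
  qed (use gh antisym_if_causal in \<open>auto simp: globally_hyperbolic_def\<close>)
qed

lemma chronologically_forward_complete_if_causally:
  assumes "spacetime M" "causally_forward_complete M"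
  shows "chronologically_forward_complete M"
proof -
  have "x \<preceq>\<^bsub>M\<^esub> y" if "x \<lless>\<^bsub>M\<^esub> y" for x y
    using assms(1) that timelike_imp_causal_rel unfolding spacetime_def by blast
  then show ?thesis
    using assms(2) unfolding causally_forward_complete_def chronologically_forward_complete_def by blast
qed

lemma forward_completeness_characterization:
  assumes "spacetime M" "closed {(x, y). x \<preceq>\<^bsub>M\<^esub> y}"
  shows "globally_hyperbolic M \<longleftrightarrow> chronologically_forward_complete M"
    and "globally_hyperbolic M \<longleftrightarrow> causally_forward_complete M"
  using globally_hyperbolic_if_chronologically_forward_complete[OF assms]
    causally_forward_complete_if_globally_hyperbolic[OF assms]
    chronologically_forward_complete_if_causally[OF assms(1)]
  by blast+

section \<open>Time reversal\<close>

lemma bilinear_metric: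
  "spacetime M \<Longrightarrow> c \<in> atlas M \<Longrightarrow> x \<in> chart_dom c \<Longrightarrow> bilinear (metric M c x)"
  unfolding spacetime_def lorentz_metric_def lorentz_form_def by blast

lemma time_reversal_simps [simp]:
  "atlas (time_reversal M) = atlas M" "metric (time_reversal M) = metric M"
  "time_field (time_reversal M) = (\<lambda>c x. - time_field M c x)"
  "time_reversal (time_reversal M) = M"
  by (simp_all add: time_reversal_def)

text \<open>Only the time orientation changes. Negating the field commutes with changes of
  coordinates because these are derivatives of transition maps, hence linear.\<close>

lemma spacetime_time_reversal:
  assumes M: "spacetime M"
  shows "spacetime (time_reversal M)"
proof -
  have "time_oriented (time_reversal M)"
    unfolding time_oriented_def time_reversal_simps
  proof (intro conjI ballI)
    have t: "time_oriented M" using M unfolding spacetime_def by blast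
    fix c assume c: "c \<in> atlas M"
    show "continuous_on (chart_dom c) (\<lambda>x. - time_field M c x)"
      using t c unfolding time_oriented_def by (intro continuous_intros) blast
    show "metric M c x (- time_field M c x) (- time_field M c x) < 0" if "x \<in> chart_dom c" for x
    proof -
      have "metric M c x (time_field M c x) (time_field M c x) < 0"
        using t c that unfolding time_oriented_def by blast
      then show ?thesis
        by (simp add: bilinear_lneg[OF bilinear_metric[OF M c that]] bilinear_rneg[OF bilinear_metric[OF M c that]])
    qed
    fix d x assume d: "d \<in> atlas M" and x: "x \<in> chart_dom c \<inter> chart_dom d"
    have "smooth_on (chart_map c ` (chart_dom c \<inter> chart_dom d)) (transition c d)"
      using M c d unfolding spacetime_def smooth_atlas_def by blast
    from smooth_on_has_derivative[OF this imageI[OF x]]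
    have "linear (change_of_coords c d x)"
      unfolding change_of_coords_def by (rule has_derivative_linear)
    then have "change_of_coords c d x (- time_field M c x) = - change_of_coords c d x (time_field M c x)"
      by (rule linear_neg)
    moreover have "time_field M d x = change_of_coords c d x (time_field M c x)"
      using t c d x unfolding time_oriented_def by blast
    ultimately show "- time_field M d x = change_of_coords c d x (- time_field M c x)"
      by metis
  qed
  moreover have "lorentz_metric (time_reversal M) \<longleftrightarrow> lorentz_metric M"
    unfolding lorentz_metric_def time_reversal_simps ..
  ultimately show ?thesis using M unfolding spacetime_def time_reversal_simps by blast
qed

lemma curve_step_time_reversal:
  assumes M: "spacetime M" and step: "curve_step M (future_causal M) x y"
  shows "curve_step (time_reversal M) (future_causal (time_reversal M)) y x"
proof -
  obtain a b \<gamma> where \<gamma>: "a < b" "C1_curve_on M (future_causal M) {a..b} \<gamma>" "\<gamma> a = x" "\<gamma> b = y"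
    using step unfolding curve_step_def by blast
  have "C1_curve_on (time_reversal M) (future_causal (time_reversal M)) {-b..-a} (\<lambda>t. \<gamma> (- 1 * t + 0))"
  proof (rule C1_curve_on_affine[OF \<gamma>(2)])
    fix c x v assume "c \<in> atlas M" "x \<in> chart_dom c" "future_causal M c x v"
    then show "future_causal (time_reversal M) c x (-1 *\<^sub>R v)"
      using bilinear_metric[OF M] by (simp add: future_causal_def bilinear_lneg bilinear_rneg)
  qed auto
  from curve_stepI[OF this] show ?thesis using \<gamma> by simp
qed

text \<open>Reversal is an involution, so one inclusion, applied to \<open>M\<close> and to its
  reversal, gives both.\<close>

lemma causal_rel_time_reversal:
  assumes M: "spacetime M"
  shows "x \<preceq>\<^bsub>time_reversal M\<^esub> y \<longleftrightarrow> y \<preceq>\<^bsub>M\<^esub> x"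
proof -
  have *: "curve_step (time_reversal M) (future_causal (time_reversal M)) =
      (curve_step M (future_causal M))\<inverse>\<inverse>"
    using curve_step_time_reversal[OF M] curve_step_time_reversal[OF spacetime_time_reversal[OF M]]
    by (auto simp: fun_eq_iff)
  show ?thesis unfolding causal_rel_iff_rtranclp *
    by (auto dest: rtranclp_converseD intro: rtranclp_converseI)
qed

text \<open>Causality is traded for antisymmetry of \<preceq>, an equivalent form in which reversal
  merely swaps the two arguments.\<close>

lemma globally_hyperbolic_time_reversal:
  assumes M: "spacetime M"
  shows "globally_hyperbolic (time_reversal M) \<longleftrightarrow> globally_hyperbolic M"
proof -
  note M' = spacetime_time_reversal[OF M]
  have "causal (time_reversal M) \<longleftrightarrow> causal M"
    using causal_if_antisym[OF M] causal_if_antisym[OF M'] antisym_if_causal[of M]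
      antisym_if_causal[of "time_reversal M"] unfolding causal_rel_time_reversal[OF M] by blast
  moreover have "causal_diamond (time_reversal M) x y = causal_diamond M y x" for x y
    unfolding causal_diamond_def causal_rel_time_reversal[OF M] by blast
  ultimately show ?thesis unfolding globally_hyperbolic_def by auto
qed

lemma closed_causal_rel_time_reversal:
  assumes M: "spacetime M" and "closed {(x, y). x \<preceq>\<^bsub>M\<^esub> y}"
  shows "closed {(x, y). x \<preceq>\<^bsub>time_reversal M\<^esub> y}"
proof -
  have "closed (prod.swap -` {(x, y). x \<preceq>\<^bsub>M\<^esub> y})"
    by (intro closed_vimage assms(2) continuous_on_swap)
  moreover have "prod.swap -` {(x, y). x \<preceq>\<^bsub>M\<^esub> y} = {(x, y). x \<preceq>\<^bsub>time_reversal M\<^esub> y}"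
    by (auto simp: causal_rel_time_reversal[OF M])
  ultimately show ?thesis by simp
qed

text \<open>Backward completeness is forward completeness of the reversal, and global hyperbolicity
  does not see the orientation, so the forward equivalences for both orientations suffice.\<close>

theorem theoremA4:
  fixes M :: "('a::{t2_space, second_countable_topology}, 'e::euclidean_space) lorentz_structure"
  assumes "spacetime M"
    and "closed {(x, y). x \<preceq>\<^bsub>M\<^esub> y}"
  shows "(globally_hyperbolic M \<longleftrightarrow> chronologically_forward_complete M) \<and>
         (globally_hyperbolic M \<longleftrightarrow> chronologically_backward_complete M) \<and>
         (globally_hyperbolic M \<longleftrightarrow> causally_forward_complete M) \<and>
         (globally_hyperbolic M \<longleftrightarrow> causally_backward_complete M)"
  unfolding chronologically_backward_complete_def causally_backward_complete_def
  using forward_completeness_characterization[OF assms]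
    forward_completeness_characterization[OF spacetime_time_reversal[OF assms(1)]
      closed_causal_rel_time_reversal[OF assms]]
    globally_hyperbolic_time_reversal[OF assms(1)]
  by blast

end
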